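(* Let $p\geq 5$ be prime, let $A$ be a $k\times n$ matrix over $\mathbb{F}_p$ of rank $k$ with $d_A=d$, and let $b\in\mathbb{F}_p^k$ be such that $A\cdot x=b$ has no solution in $\{0,1\}^n$. Then in the LinTrees$^{(p)}$ Prover–Delayer game on $A\cdot x=b$ there exists a Delayer strategy that guarantees selection of $\Omega(d^{0.2})$ branching points (i.e. at least $c\,d^{0.2}$ branching points for a constant $c>0$ depending only on $p$).
   Context: For $v\in\mathbb{F}_p^n$, $\omega(v)$ is the number of nonzero coordinates; $d_A:=\min_{y\neq 0}\omega(y\cdot A)$. For a linear form $f$ in $x_1,\dots,x_n$, $f(\{0,1\}^n)\subseteq\mathbb{F}_p$ is its set of values on Boolean assignments. LinTrees$^{(p)}$ Prover–Delayer game on a 0-1 unsatisfiable linear system $\mathcal{F}$: a position is a set $\mathcal{H}$ of linear equations; the game starts with $\mathcal{H}=\mathcal{F}$. In each round Prover chooses a linear form $f$; Delayer either chooses some $a\in f(\{0,1\}^n)$ and the equation $f=a$ is added to $\mathcal{H}$, or declares the position a branching point and chooses $a_1\neq a_2\in f(\{0,1\}^n)$, after which Prover chooses which of $f=a_1$, $f=a_2$ is added to $\mathcal{H}$. The game ends when $\mathcal{H}$ has no solution in $\mathbb{F}_p^n$. A Delayer strategy guarantees selection of $h$ branching points if in every play consistent with it (against any Prover), at least $h$ branching points are declared before the game ends. *)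

theory Defs
  imports
    Complex_Main
    "Jordan_Normal_Form.DL_Rank"
    "Berlekamp_Zassenhaus.Finite_Field"
begin

definition weight :: "'a::zero vec \<Rightarrow> nat" where
  "weight v = card {i. i < dim_vec v \<and> v $ i \<noteq> 0}"

text \<open>The row vector \<open>y \<cdot> A\<close> is written as the column vector \<open>transpose_mat A *\<^sub>v y\<close>.
  The minimum is over a nonempty set only if \<open>A\<close> has at least one row.\<close>

definition min_weight :: "'a::field mat \<Rightarrow> nat" where
  "min_weight A =
     Min {weight (transpose_mat A *\<^sub>v y) | y. y \<in> carrier_vec (dim_row A) \<and> y \<noteq> 0\<^sub>v (dim_row A)}"

definition boolean_points :: "nat \<Rightarrow> 'a::field vec set" where
  "boolean_points n = {x \<in> carrier_vec n. \<forall>i<n. x $ i \<in> {0, 1}}"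

text \<open>A linear form in \<open>n\<close> variables is given by its coefficient vector in \<open>carrier_vec n\<close>;
  the pair \<open>(f, a)\<close> is the equation \<open>f = a\<close>.\<close>

type_synonym 'a lin_eq = "'a vec \<times> 'a"

definition boolean_values :: "nat \<Rightarrow> 'a::field vec \<Rightarrow> 'a set" where
  "boolean_values n f = (\<lambda>x. f \<bullet> x) ` boolean_points n"

definition solvable :: "nat \<Rightarrow> 'a::field lin_eq set \<Rightarrow> bool" where
  "solvable n H \<longleftrightarrow> (\<exists>x \<in> carrier_vec n. \<forall>(f, a) \<in> H. f \<bullet> x = a)"

definition system :: "'a mat \<Rightarrow> 'a vec \<Rightarrow> 'a lin_eq set" where
  "system A b = {(row A i, b $ i) | i. i < dim_row A}"

text \<open>Delayer's reaction to a linear form: either a single value, or a branching point offering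
  two values between which Prover chooses.\<close>

datatype 'a response = Answer 'a | Branch 'a 'a

fun legal_response :: "nat \<Rightarrow> 'a::field vec \<Rightarrow> 'a response \<Rightarrow> bool" where
  "legal_response n f (Answer a) \<longleftrightarrow> a \<in> boolean_values n f"
| "legal_response n f (Branch a1 a2) \<longleftrightarrow>
     a1 \<in> boolean_values n f \<and> a2 \<in> boolean_values n f \<and> a1 \<noteq> a2"

fun outcomes :: "'a response \<Rightarrow> 'a set" where
  "outcomes (Answer a) = {a}"
| "outcomes (Branch a1 a2) = {a1, a2}"

fun branch_count :: "'a response \<Rightarrow> nat" where
  "branch_count (Answer a) = 0"
| "branch_count (Branch a1 a2) = 1"

text \<open>A strategy sees the equations added in the previous rounds, in chronological order, and
  Prover's current form. Delayer's own earlier responses need not be recorded, since the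
  strategy determines them from this list.\<close>

type_synonym 'a delayer_strategy = "'a lin_eq list \<Rightarrow> 'a vec \<Rightarrow> 'a response"

definition legal_strategy :: "nat \<Rightarrow> 'a::field delayer_strategy \<Rightarrow> bool" where
  "legal_strategy n S \<longleftrightarrow> (\<forall>es. \<forall>f \<in> carrier_vec n. legal_response n f (S es f))"

text \<open>\<open>play n F S es m\<close>: starting from \<open>F\<close>, against some Prover, the strategy \<open>S\<close> can lead to the
  sequence \<open>es\<close> of added equations, with \<open>m\<close> branching points declared on the way. A further
  round is played only while the position \<open>F \<union> set es\<close> is solvable.\<close>

inductive play ::
  "nat \<Rightarrow> 'a::field lin_eq set \<Rightarrow> 'a delayer_strategy \<Rightarrow> 'a lin_eq list \<Rightarrow> nat \<Rightarrow> bool"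
  for n F S where
  start: "play n F S [] 0"
| round: "play n F S es m \<Longrightarrow> solvable n (F \<union> set es) \<Longrightarrow> f \<in> carrier_vec n \<Longrightarrow>
    a \<in> outcomes (S es f) \<Longrightarrow> play n F S (es @ [(f, a)]) (m + branch_count (S es f))"

text \<open>The bound concerns plays that end. Prover can make a play infinite, for instance by asking
  the zero form forever, and then no branching point need ever be possible.\<close>

definition guarantees ::
  "nat \<Rightarrow> 'a::field lin_eq set \<Rightarrow> 'a delayer_strategy \<Rightarrow> nat \<Rightarrow> bool" where
  "guarantees n F S h \<longleftrightarrow> legal_strategy n S \<and>
     (\<forall>es m. play n F S es m \<longrightarrow> \<not> solvable n (F \<union> set es) \<longrightarrow> h \<le> m)"

end

theory Submission
  imports Defs
begin

text \<open>Delayer looks at the space \<open>W\<close> spanned by all equations known so far and answers according to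
  it whenever the form is determined by \<open>W\<close>. The light elements of \<open>W\<close> span a space \<open>T\<close> which meets
  the row space of \<open>A\<close> trivially, hence has small dimension, and the play is safe as long as \<open>T\<close> has a
  Boolean solution: a heavy form takes every value on the cube, and a light one takes its forced
  value. If a new form creates no new light element, any two values may be offered. Otherwise it
  is determined modulo \<open>W\<close> by one light form \<open>g\<close>. The differences of light elements of the new coset
  are added to \<open>T\<close>; this leaves Boolean solutions by a Fourier estimate, because every element of \<open>W\<close>
  outside \<open>T\<close> is heavy. Then Delayer branches if \<open>g\<close> is not constant on the Boolean solutions of \<open>T\<close>,
  and otherwise gives the only value.

  By Warning's second theorem \<open>t\<close> equations over a field with \<open>p\<close> elements with a common Boolean
  solution have at least \<open>2 ^ (n - (p - 1) * t)\<close> of them, while a space of dimension \<open>j\<close> has at most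
  \<open>2 ^ (n - j)\<close>. So the number of answers implied in this way is at most \<open>p - 1\<close> times the number of
  branching points. The argument works while the dimension of \<open>W\<close> over the row space is of order
  at most the square root of \<open>d\<close>.\<close>

section \<open>Boolean solutions of linear equations\<close>

text \<open>In the indicator variables of \<open>S\<close> the product has degree at most
  \<open>card J\<close>, while the alternating sum extracts the coefficient of the full monomial
  over \<open>N\<close>, whose degree is too high to occur.\<close>

lemma alternating_sum_prod_affine:
  fixes L :: "'j \<Rightarrow> 'i \<Rightarrow> 'a::comm_ring_1"
  assumes "finite J" "finite N" "card J < card N"
  shows "(\<Sum>S\<in>Pow N. (-1) ^ card S * (\<Prod>j\<in>J. c j + sum (L j) S)) = 0"
  using assms
proof (induction J arbitrary: N c rule: finite_induct)
  case empty
  then obtain i where i: "i \<in> N" by fastforce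
  have "(\<Prod>x\<in>N. (-1) + (1::'a)) = (\<Sum>X\<in>Pow N. (\<Prod>x\<in>X. -1) * (\<Prod>x\<in>N-X. 1))"
    by (rule prod_add) fact
  moreover have "(\<Prod>x\<in>N. (-1) + (1::'a)) = 0"
    using i empty.prems by (intro prod_zero) auto
  ultimately show ?case by simp
next
  case (insert j J)
  define P where "P S = (\<Prod>k\<in>J. c k + sum (L k) S)" for S
  have fin: "finite N" by fact
  have const: "(\<Sum>S\<in>Pow N. (-1) ^ card S * P S) = 0"
    unfolding P_def using insert by (intro insert.IH) auto
  \<comment> \<open>Fixing \<open>i\<close> in \<open>S\<close> shifts each \<open>c k\<close> by
    \<open>L k i\<close> and flips the sign. One factor and one variable are lost, so the degree
    condition persists.\<close>
  have coord: "(\<Sum>S\<in>Pow N. (-1) ^ card S * P S * (if i \<in> S then 1 else 0)) = 0" if "i \<in> N" for i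
  proof -
    have "(\<Sum>S\<in>Pow N. (-1) ^ card S * P S * (if i \<in> S then 1 else 0))
        = (\<Sum>S\<in>{S. S \<subseteq> N \<and> i \<in> S}. (-1) ^ card S * P S)"
      using fin by (intro sum.mono_neutral_cong_right) auto
    also have "\<dots> = (\<Sum>S\<in>Pow (N - {i}). (-1) ^ card (insert i S) * P (insert i S))"
      by (rule sum.reindex_bij_witness[where j = "\<lambda>S. S - {i}" and i = "insert i"])
         (use that in \<open>auto simp: insert_absorb\<close>)
    also have "\<dots> = (\<Sum>S\<in>Pow (N - {i}). - ((-1) ^ card S * (\<Prod>k\<in>J. (c k + L k i) + sum (L k) S)))"
    proof (rule sum.cong[OF refl])
      fix S assume "S \<in> Pow (N - {i})"
      then have "finite S" "i \<notin> S" using fin finite_subset by auto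
      then show "(-1) ^ card (insert i S) * P (insert i S)
          = - ((-1) ^ card S * (\<Prod>k\<in>J. (c k + L k i) + sum (L k) S))"
        by (simp add: P_def add.assoc)
    qed
    also have "\<dots> = - (\<Sum>S\<in>Pow (N - {i}). (-1) ^ card S * (\<Prod>k\<in>J. (c k + L k i) + sum (L k) S))"
      by (simp add: sum_negf)
    also have "(\<Sum>S\<in>Pow (N - {i}). (-1) ^ card S * (\<Prod>k\<in>J. (c k + L k i) + sum (L k) S)) = 0"
      using insert that by (intro insert.IH) auto
    finally show ?thesis by simp
  qed
  have "(\<Sum>S\<in>Pow N. (-1) ^ card S * (\<Prod>k\<in>insert j J. c k + sum (L k) S))
      = (\<Sum>S\<in>Pow N. c j * ((-1) ^ card S * P S)
          + (\<Sum>i\<in>N. L j i * ((-1) ^ card S * P S * (if i \<in> S then 1 else 0))))"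
  proof (rule sum.cong[OF refl])
    fix S assume "S \<in> Pow N"
    then have "sum (L j) S = (\<Sum>i\<in>N. L j i * (if i \<in> S then 1 else 0))"
      using fin by (intro sum.mono_neutral_cong_left) auto
    then show "(-1) ^ card S * (\<Prod>k\<in>insert j J. c k + sum (L k) S)
      = c j * ((-1) ^ card S * P S)
          + (\<Sum>i\<in>N. L j i * ((-1) ^ card S * P S * (if i \<in> S then 1 else 0)))"
      using insert.hyps by (simp add: P_def algebra_simps sum_distrib_left)
  qed
  also have "\<dots> = c j * (\<Sum>S\<in>Pow N. (-1) ^ card S * P S)
      + (\<Sum>i\<in>N. L j i * (\<Sum>S\<in>Pow N. (-1) ^ card S * P S * (if i \<in> S then 1 else 0)))"
    by (simp add: sum.distrib sum_distrib_left sum.swap[of _ N])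
  also have "\<dots> = 0"
    by (simp add: const coord)
  finally show ?case .
qed

text \<open>The indicator of the solution set is, up to a unit, a product of \<open>(q - 1) * card E\<close> affine
  forms.\<close>

lemma olson_other_solution:
  fixes L :: "'e \<Rightarrow> 'i \<Rightarrow> 'a::{field,finite}"
  assumes "finite E" "finite N" "(CARD('a) - 1) * card E < card N"
    and "S0 \<subseteq> N" "\<forall>e\<in>E. sum (L e) S0 = c e"
  shows "\<exists>S\<subseteq>N. S \<noteq> S0 \<and> (\<forall>e\<in>E. sum (L e) S = c e)"
proof (rule ccontr)
  assume unique: "\<not> ?thesis"
  define J where "J = E \<times> (UNIV - {0::'a})"
  \<comment> \<open>For each \<open>e\<close> the factors are \<open>t - a\<close> over all nonzero
    \<open>a\<close>, where \<open>t = sum (L e) S - c e\<close>; their product is nonzero exactly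
    when \<open>t = 0\<close>.\<close>
  define F where "F S = (\<Prod>(e, a)\<in>J. (- c e - a) + sum (L e) S)" for S
  have J: "finite J" "card J < card N"
    using assms by (simp_all add: J_def card_cartesian_product card_Diff_singleton mult.commute)
  have F0: "F S = 0" if S: "S \<in> Pow N" "S \<noteq> S0" for S
  proof -
    obtain e where e: "e \<in> E" "sum (L e) S \<noteq> c e"
      using unique S by auto
    then have "(e, sum (L e) S - c e) \<in> J"
      by (simp add: J_def)
    then show ?thesis
      unfolding F_def using J(1)
      by (intro prod_zero bexI[of _ "(e, sum (L e) S - c e)"]) simp_all
  qed
  have "F S0 \<noteq> 0"
    unfolding F_def using J(1) assms(5) by (auto simp: J_def)
  \<comment> \<open>The number of factors is below \<open>card N\<close>, so the alternating sum
    vanishes, yet uniqueness leaves only the nonzero term of \<open>S0\<close>.\<close>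
  have "0 = (\<Sum>S\<in>Pow N. (-1) ^ card S * F S)"
    unfolding F_def split_def using J assms(2) by (intro alternating_sum_prod_affine[symmetric]) auto
  also have "\<dots> = (\<Sum>S\<in>{S0}. (-1) ^ card S * F S)"
    using assms(2,4) F0 by (intro sum.mono_neutral_right) auto
  finally show False
    using \<open>F S0 \<noteq> 0\<close> by simp
qed

text \<open>Induction on the number of variables. A second solution makes some variable take both
  values on solutions; each half is a solvable system in one variable fewer with the same loss
  factor, and the two counts add up.\<close>

lemma warning_boolean:
  fixes L :: "'e \<Rightarrow> 'i \<Rightarrow> 'a::{field,finite}"
  assumes "finite E" "finite N"
    and "S0 \<subseteq> N" "\<forall>e\<in>E. sum (L e) S0 = c e"
  shows "2 ^ card N \<le> card {S. S \<subseteq> N \<and> (\<forall>e\<in>E. sum (L e) S = c e)} * 2 ^ ((CARD('a) - 1) * card E)"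
  using assms(2-)
proof (induction "card N" arbitrary: N S0 c rule: less_induct)
  case less
  let ?X = "\<lambda>N c. {S. S \<subseteq> N \<and> (\<forall>e\<in>E. sum (L e) S = c e)}"
  let ?D = "2 ^ ((CARD('a) - 1) * card E) :: nat"
  have finX: "finite (?X N c)"
    using less.prems(1) by simp
  show ?case
  proof (cases "(CARD('a) - 1) * card E < card N")
    case False
    have "card (?X N c) \<ge> 1"
      using finX less.prems by (auto simp: Suc_le_eq card_gt_0_iff)
    have "2 ^ card N \<le> 1 * ?D"
      using False by simp
    also have "\<dots> \<le> card (?X N c) * ?D"
      using \<open>card (?X N c) \<ge> 1\<close> by (intro mult_right_mono) auto
    finally show ?thesis .
  next
    case True
    obtain S1 where S1: "S1 \<subseteq> N" "S1 \<noteq> S0" "\<forall>e\<in>E. sum (L e) S1 = c e"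
      using olson_other_solution[OF assms(1) less.prems(1) True less.prems(2,3)] by auto
    then obtain i U V where i: "i \<in> U" "i \<notin> V" "U \<in> ?X N c" "V \<in> ?X N c"
      using less.prems by (smt (verit) mem_Collect_eq subset_antisym subset_iff)
    then have iN: "i \<in> N" by auto
    define N' where "N' = N - {i}"
    have N': "finite N'" "card N' < card N" "card N = Suc (card N')"
      using iN less.prems(1) card_Suc_Diff1[OF less.prems(1) iN] by (simp_all add: N'_def)
    have without: "2 ^ card N' \<le> card (?X N' c) * ?D"
      using i N' by (intro less.hyps[of N' V c]) (auto simp: N'_def)
    have shift: "sum (L e) (insert i S) = L e i + sum (L e) S" if "S \<subseteq> N'" for S e
      using that N'(1) finite_subset by (subst sum.insert) (auto simp: N'_def)
    have "sum (L e) (U - {i}) = c e - L e i" if "e \<in> E" for e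
    proof -
      have "sum (L e) (insert i (U - {i})) = L e i + sum (L e) (U - {i})"
        using i by (intro shift) (auto simp: N'_def)
      then show ?thesis
        using i that by (simp add: insert_absorb)
    qed
    then have "with": "2 ^ card N' \<le> card (?X N' (\<lambda>e. c e - L e i)) * ?D"
      using i N' by (intro less.hyps[of N' "U - {i}"]) (auto simp: N'_def)
    have "insert i ` ?X N' (\<lambda>e. c e - L e i) \<union> ?X N' c \<subseteq> ?X N c"
      using iN by (auto simp: shift) (auto simp: N'_def)
    then have "card (insert i ` ?X N' (\<lambda>e. c e - L e i) \<union> ?X N' c) \<le> card (?X N c)"
      by (rule card_mono[OF finX])
    moreover have "card (insert i ` ?X N' (\<lambda>e. c e - L e i) \<union> ?X N' c)
        = card (insert i ` ?X N' (\<lambda>e. c e - L e i)) + card (?X N' c)"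
      using N'(1) by (intro card_Un_disjoint) (auto simp: N'_def)
    moreover have "card (insert i ` ?X N' (\<lambda>e. c e - L e i)) = card (?X N' (\<lambda>e. c e - L e i))"
      by (intro card_image inj_onI) (auto simp: N'_def)
    ultimately have "(card (?X N' (\<lambda>e. c e - L e i)) + card (?X N' c)) * ?D \<le> card (?X N c) * ?D"
      by (intro mult_right_mono) auto
    then show ?thesis
      using without "with" unfolding N'(3) by (simp add: distrib_right)
  qed
qed

section \<open>Spaces of equations\<close>

text \<open>The equation \<open>\<Sum>i<n. a i * x i = c\<close> is the function \<open>e\<close> with \<open>e i = a i\<close> for \<open>i < n\<close> and \<open>e n = c\<close>;
  a Boolean assignment is the set of variables that are \<open>1\<close>.\<close>

definition eq_space :: "(nat \<Rightarrow> 'a::field) set \<Rightarrow> bool" where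
  "eq_space V \<longleftrightarrow> finite V \<and> (\<lambda>_. 0) \<in> V \<and>
     (\<forall>e\<in>V. \<forall>g\<in>V. \<forall>c. (\<lambda>i. e i + c * g i) \<in> V)"

definition adjoin :: "(nat \<Rightarrow> 'a::field) \<Rightarrow> (nat \<Rightarrow> 'a) set \<Rightarrow> (nat \<Rightarrow> 'a) set" where
  "adjoin e V = (\<lambda>(v, c) i. v i + c * e i) ` (V \<times> UNIV)"

definition sols :: "nat \<Rightarrow> (nat \<Rightarrow> 'a::field) set \<Rightarrow> nat set set" where
  "sols n V = {S. S \<subseteq> {..<n} \<and> (\<forall>e\<in>V. sum e S = e n)}"

definition wt :: "nat \<Rightarrow> (nat \<Rightarrow> 'a::field) \<Rightarrow> nat" where
  "wt n e = card {i. i < n \<and> e i \<noteq> 0}"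

text \<open>Excludes contradictions \<open>0 = c\<close> with nonzero \<open>c\<close>, which for a
  space amounts to solvability over the field. Vanishing above \<open>n\<close> leaves an element
  determined by its form and right-hand side.\<close>

definition consistent :: "nat \<Rightarrow> (nat \<Rightarrow> 'a::field) set \<Rightarrow> bool" where
  "consistent n V \<longleftrightarrow> (\<forall>e\<in>V. (\<forall>i>n. e i = 0) \<and> ((\<forall>i<n. e i = 0) \<longrightarrow> e n = 0))"

lemma consistentD:
  assumes "consistent n V" "e \<in> V" "\<And>i. i < n \<Longrightarrow> e i = 0"
  shows "e = (\<lambda>_. 0)"
proof
  fix i show "e i = 0"
    using assms by (cases i n rule: linorder_cases) (auto simp: consistent_def)
qed

lemma consistent_subset: "consistent n V \<Longrightarrow> U \<subseteq> V \<Longrightarrow> consistent n U"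
  by (auto simp: consistent_def)

lemma eq_space_lincomb: "eq_space V \<Longrightarrow> e \<in> V \<Longrightarrow> g \<in> V \<Longrightarrow> (\<lambda>i. e i + c * g i) \<in> V"
  by (simp add: eq_space_def)

lemma eq_space_diff: "eq_space V \<Longrightarrow> e \<in> V \<Longrightarrow> g \<in> V \<Longrightarrow> (\<lambda>i. e i - c * g i) \<in> V"
  using eq_space_lincomb[of V e g "- c"] by simp

lemma eq_space_scale:
  assumes "eq_space V" "e \<in> V" shows "(\<lambda>i. c * e i) \<in> V"
  using eq_space_lincomb[OF assms(1) _ assms(2), of "\<lambda>_. 0" c] assms(1) by (simp add: eq_space_def)

lemma finite_eq_space: "eq_space V \<Longrightarrow> finite V"
  and zero_in_eq_space: "eq_space V \<Longrightarrow> (\<lambda>_. 0) \<in> V"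
  by (simp_all add: eq_space_def)

lemma eq_space_zero: "eq_space {\<lambda>_. 0}"
  by (simp add: eq_space_def)

lemma adjoinI: "v \<in> V \<Longrightarrow> (\<lambda>i. v i + c * e i) \<in> adjoin e V"
  by (force simp: adjoin_def)

lemma adjoinE:
  assumes "u \<in> adjoin e V"
  obtains v c where "v \<in> V" "u = (\<lambda>i. v i + c * e i)"
  using assms by (auto simp: adjoin_def)

lemma adjoin_base: "V \<subseteq> adjoin e V"
proof
  fix v assume "v \<in> V"
  then show "v \<in> adjoin e V" using adjoinI[of v V 0 e] by simp
qed

lemma adjoin_new: "eq_space V \<Longrightarrow> e \<in> adjoin e V"
  using adjoinI[of "\<lambda>_. 0" V 1 e] by (simp add: zero_in_eq_space)

lemma adjoin_subset: "eq_space W \<Longrightarrow> V \<subseteq> W \<Longrightarrow> e \<in> W \<Longrightarrow> adjoin e V \<subseteq> W"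
  by (auto elim!: adjoinE intro: eq_space_lincomb)

lemma adjoin_absorb: "eq_space V \<Longrightarrow> e \<in> V \<Longrightarrow> adjoin e V = V"
  using adjoin_base adjoin_subset by blast

lemma eq_space_adjoin:
  fixes V :: "(nat \<Rightarrow> 'a::{field,finite}) set"
  assumes V: "eq_space V" shows "eq_space (adjoin e V)"
  unfolding eq_space_def
proof (intro conjI ballI allI)
  show "finite (adjoin e V)"
    using finite_eq_space[OF V] by (simp add: adjoin_def)
  show "(\<lambda>_. 0) \<in> adjoin e V"
    using zero_in_eq_space[OF V] adjoin_base by blast
  fix u v c assume "u \<in> adjoin e V" "v \<in> adjoin e V"
  then obtain u' a v' b where
    u: "u' \<in> V" "u = (\<lambda>i. u' i + a * e i)" and v: "v' \<in> V" "v = (\<lambda>i. v' i + b * e i)"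
    by (auto elim!: adjoinE)
  have "(\<lambda>i. (u' i + c * v' i) + (a + c * b) * e i) \<in> adjoin e V"
    using adjoinI[OF eq_space_lincomb[OF V u(1) v(1)]] .
  then show "(\<lambda>i. u i + c * v i) \<in> adjoin e V"
    unfolding u v by (simp add: algebra_simps)
qed

text \<open>Two representations with different multiples of \<open>e\<close> would put
  \<open>e\<close> into \<open>V\<close>. Dimensions are recorded throughout as exponents of
  cardinalities.\<close>

lemma card_adjoin:
  fixes V :: "(nat \<Rightarrow> 'a::{field,finite}) set"
  assumes V: "eq_space V" and e: "e \<notin> V"
  shows "card (adjoin e V) = CARD('a) * card V"
proof -
  have "inj_on (\<lambda>(v, c) i. v i + c * e i) (V \<times> UNIV)"
  proof (rule inj_onI, clarsimp)
    fix v c v' c' assume v: "v \<in> V" "v' \<in> V" and eq: "(\<lambda>i. v i + c * e i) = (\<lambda>i. v' i + c' * e i)"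
    have eq': "v i + c * e i = v' i + c' * e i" for i
      using fun_cong[OF eq, of i] .
    have "c = c'"
    proof (rule ccontr)
      assume "c \<noteq> c'"
      then have "e = (\<lambda>i. (1 / (c - c')) * (v' i - 1 * v i))"
        using eq' by (auto simp: fun_eq_iff field_simps)
      then show False
        using e eq_space_scale[OF V eq_space_diff[OF V v(2,1), of 1], of "1 / (c - c')"] by simp
    qed
    then show "v = v' \<and> c = c'"
      using eq' by (auto simp: fun_eq_iff)
  qed
  then show ?thesis
    by (simp add: adjoin_def card_image card_cartesian_product mult.commute)
qed

lemma sols_adjoin:
  assumes "eq_space V"
  shows "sols n (adjoin e V) = {S \<in> sols n V. sum e S = e n}"
proof (intro equalityI subsetI)
  fix S assume S: "S \<in> sols n (adjoin e V)"
  then show "S \<in> {S \<in> sols n V. sum e S = e n}"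
    using adjoin_base[of V e] adjoin_new[OF assms, of e] by (auto simp: sols_def)
next
  fix S assume "S \<in> {S \<in> sols n V. sum e S = e n}"
  then show "S \<in> sols n (adjoin e V)"
    by (auto simp: sols_def sum.distrib sum_distrib_left[symmetric] elim!: adjoinE)
qed

lemma sols_insert: "sols n (insert e E) = {S \<in> sols n E. sum e S = e n}"
  by (auto simp: sols_def)

lemma finite_sols: "finite (sols n V)"
  by (rule finite_subset[of _ "Pow {..<n}"]) (auto simp: sols_def)

lemma wt_lincomb: "wt n (\<lambda>i. e i + c * g i) \<le> wt n e + wt n g"
proof -
  have "wt n (\<lambda>i. e i + c * g i) \<le> card ({i. i < n \<and> e i \<noteq> 0} \<union> {i. i < n \<and> g i \<noteq> 0})"
    unfolding wt_def by (intro card_mono) auto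
  also have "\<dots> \<le> wt n e + wt n g"
    unfolding wt_def by (rule card_Un_le)
  finally show ?thesis .
qed

lemma wt_diff: "wt n (\<lambda>i. e i - c * g i) \<le> wt n e + wt n g"
  using wt_lincomb[of n e "- c" g] by simp

lemma wt_scale: "c \<noteq> 0 \<Longrightarrow> wt n (\<lambda>i. c * e i) = wt n e"
  by (simp add: wt_def)

lemma wt_cong: "(\<And>i. i < n \<Longrightarrow> e i = g i) \<Longrightarrow> wt n e = wt n g"
  unfolding wt_def by (metis (mono_tags, lifting))

lemma wt_eq_0_iff: "wt n e = 0 \<longleftrightarrow> (\<forall>i<n. e i = 0)"
  by (auto simp: wt_def)

text \<open>The exponent counts equations, and \<open>E\<close> need not be a space: a short list
  with the same Boolean solutions as a large space gives a better bound.\<close>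

lemma warning_sols:
  fixes E :: "(nat \<Rightarrow> 'a::{field,finite}) set"
  assumes "finite E" "sols n E \<noteq> {}"
  shows "2 ^ n \<le> card (sols n E) * 2 ^ ((CARD('a) - 1) * card E)"
proof -
  obtain S where "S \<subseteq> {..<n}" "\<forall>e\<in>E. sum e S = e n"
    using assms(2) by (auto simp: sols_def)
  from warning_boolean[OF assms(1) _ this] show ?thesis
    by (simp add: sols_def)
qed

text \<open>The spaces \<open>leading n k V\<close>, for increasing \<open>k\<close>, replace Gaussian elimination.\<close>

definition leading :: "nat \<Rightarrow> nat \<Rightarrow> (nat \<Rightarrow> 'a::field) set \<Rightarrow> (nat \<Rightarrow> 'a) set" where
  "leading n k V = {e \<in> V. \<forall>l<n. k \<le> l \<longrightarrow> e l = 0}"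

lemma eq_space_leading: "eq_space V \<Longrightarrow> eq_space (leading n k V)"
  by (auto simp: leading_def eq_space_def)

lemma leading_0: "consistent n V \<Longrightarrow> eq_space V \<Longrightarrow> leading n 0 V = {\<lambda>_. 0}"
  by (auto simp: leading_def zero_in_eq_space intro: consistentD)

lemma leading_self: "leading n n V = V"
  by (simp add: leading_def)

lemma leading_mono: "leading n k V \<subseteq> leading n (Suc k) V"
  by (auto simp: leading_def)

section \<open>Elimination: solvability and an upper bound for Boolean solutions\<close>

lemma leading_Suc_pivot:
  assumes V: "eq_space V" and g: "g \<in> leading n (Suc k) V" "g k \<noteq> 0"
    and e: "e \<in> leading n (Suc k) V"
  shows "(\<lambda>i. e i - (e k / g k) * g i) \<in> leading n k V"
  using eq_space_diff[OF V, of e g "e k / g k"] g e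
  by (auto simp: leading_def Suc_le_eq le_less)

lemma leading_Suc_adjoin:
  assumes V: "eq_space V" and g: "g \<in> leading n (Suc k) V" "g k \<noteq> 0"
  shows "leading n (Suc k) V = adjoin g (leading n k V)"
proof
  show "adjoin g (leading n k V) \<subseteq> leading n (Suc k) V"
    by (intro adjoin_subset eq_space_leading V g leading_mono)
  show "leading n (Suc k) V \<subseteq> adjoin g (leading n k V)"
  proof
    fix e assume "e \<in> leading n (Suc k) V"
    from adjoinI[OF leading_Suc_pivot[OF V g this], of "e k / g k" g]
    show "e \<in> adjoin g (leading n k V)" by simp
  qed
qed

lemma leading_Suc_eq:
  assumes "k < n" "\<not> (\<exists>g\<in>leading n (Suc k) V. g k \<noteq> 0)"
  shows "leading n (Suc k) V = leading n k V"
  using assms by (auto simp: leading_def Suc_le_eq le_less)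

lemma consistent_solution:
  fixes V :: "(nat \<Rightarrow> 'a::field) set"
  assumes V: "eq_space V" and nd: "consistent n V"
  shows "\<exists>x. \<forall>e\<in>V. (\<Sum>i<n. e i * x i) = e n"
proof -
  have "\<exists>x. \<forall>e\<in>leading n k V. (\<Sum>i<k. e i * x i) = e n" if "k \<le> n" for k
    using that
  proof (induction k)
    case 0
    then show ?case by (simp add: leading_0[OF nd V])
  next
    case (Suc k)
    then obtain x where x: "\<forall>e\<in>leading n k V. (\<Sum>i<k. e i * x i) = e n" by auto
    show ?case
    proof (cases "\<exists>g\<in>leading n (Suc k) V. g k \<noteq> 0")
      case False
      then have "leading n (Suc k) V = leading n k V"
        using Suc.prems by (intro leading_Suc_eq) auto
      moreover have "e k = 0" if "e \<in> leading n k V" for e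
        using that Suc.prems by (auto simp: leading_def)
      ultimately show ?thesis
        using x by (intro exI[of _ x]) simp
    next
      case True
      then obtain g where g: "g \<in> leading n (Suc k) V" "g k \<noteq> 0" by auto
      \<comment> \<open>The pivot equation \<open>g\<close> determines coordinate \<open>k\<close>;
        any other equation is a multiple of \<open>g\<close> plus one in the earlier
        coordinates.\<close>
      let ?x = "x(k := (g n - (\<Sum>i<k. g i * x i)) / g k)"
      have "(\<Sum>i<Suc k. e i * ?x i) = e n" if e: "e \<in> leading n (Suc k) V" for e
      proof -
        have "e n - (e k / g k) * g n = (\<Sum>i<k. (e i - (e k / g k) * g i) * x i)"
          using bspec[OF x leading_Suc_pivot[OF V g e]] by (rule sym)
        also have "\<dots> = (\<Sum>i<k. e i * x i) - (e k / g k) * (\<Sum>i<k. g i * x i)"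
          by (simp add: left_diff_distrib sum_subtractf sum_distrib_left mult.assoc)
        finally show ?thesis
          using g(2) by (simp add: field_simps)
      qed
      then show ?thesis by blast
    qed
  qed
  from this[of n] show ?thesis
    by (simp add: leading_self)
qed

text \<open>\<open>X k\<close> holds the solutions cut off to the first \<open>k\<close> variables.
  At a pivot the earlier values determine the next variable; otherwise the count at most doubles.
  The number of pivots is the dimension.\<close>

lemma card_sols_le:
  fixes V :: "(nat \<Rightarrow> 'a::{field,finite}) set"
  assumes V: "eq_space V" and nd: "consistent n V" and card: "card V = CARD('a) ^ j"
  shows "card (sols n V) * 2 ^ j \<le> 2 ^ n"
proof -
  define X where "X k = (\<lambda>S. S \<inter> {..<k}) ` sols n V" for k
  have finX: "finite (X k)" for k
    by (simp add: X_def finite_sols)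
  have "\<exists>j. card (leading n k V) = CARD('a) ^ j \<and> card (X k) * 2 ^ j \<le> 2 ^ k" if "k \<le> n" for k
    using that
  proof (induction k)
    case 0
    have "card (X 0) \<le> card {{} :: nat set}"
      by (intro card_mono) (auto simp: X_def)
    then show ?case
      by (intro exI[of _ 0]) (simp add: leading_0[OF nd V])
  next
    case (Suc k)
    then obtain j where j: "card (leading n k V) = CARD('a) ^ j" "card (X k) * 2 ^ j \<le> 2 ^ k" by auto
    show ?case
    proof (cases "\<exists>g\<in>leading n (Suc k) V. g k \<noteq> 0")
      case False
      have "X (Suc k) \<subseteq> X k \<union> insert k ` X k"
      proof
        fix U assume "U \<in> X (Suc k)"
        then obtain S where S: "S \<in> sols n V" "U = S \<inter> {..<Suc k}" by (auto simp: X_def)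
        show "U \<in> X k \<union> insert k ` X k"
        proof (cases "k \<in> S")
          case True
          then have "U = insert k (S \<inter> {..<k})" using S by (auto simp: lessThan_Suc)
          then show ?thesis using S by (auto simp: X_def)
        next
          case False
          then have "U = S \<inter> {..<k}" using S by (auto simp: lessThan_Suc)
          then show ?thesis using S by (auto simp: X_def)
        qed
      qed
      then have "card (X (Suc k)) \<le> card (X k \<union> insert k ` X k)"
        by (intro card_mono) (auto simp: finX)
      also have "\<dots> \<le> card (X k) + card (insert k ` X k)"
        by (rule card_Un_le)
      also have "\<dots> \<le> 2 * card (X k)"
        using card_image_le[OF finX, of "insert k" k] by simp
      finally have "card (X (Suc k)) * 2 ^ j \<le> 2 * card (X k) * 2 ^ j"
        by (intro mult_right_mono) auto
      also have "\<dots> \<le> 2 ^ Suc k"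
        using j by simp
      finally have "card (X (Suc k)) * 2 ^ j \<le> 2 ^ Suc k" .
      moreover have "leading n (Suc k) V = leading n k V"
        using False Suc.prems by (intro leading_Suc_eq) auto
      ultimately show ?thesis using j(1) by (intro exI[of _ j]) simp
    next
      case True
      then obtain g where g: "g \<in> leading n (Suc k) V" "g k \<noteq> 0" by auto
      have "g \<notin> leading n k V"
        using g Suc.prems by (auto simp: leading_def intro!: exI[of _ k])
      then have "card (leading n (Suc k) V) = CARD('a) ^ Suc j"
        using card_adjoin[OF eq_space_leading[OF V]] j
        by (simp add: leading_Suc_adjoin[OF V g])
      moreover have "card (X (Suc k)) * 2 ^ Suc j \<le> 2 ^ Suc k"
      proof -
        have "card (X (Suc k)) \<le> card (X k)"
        proof (rule card_inj_on_le[where f = "\<lambda>U. U \<inter> {..<k}"])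
          show "finite (X k)" by (rule finX)
          show "(\<lambda>U. U \<inter> {..<k}) ` X (Suc k) \<subseteq> X k"
          proof safe
            fix U assume "U \<in> X (Suc k)"
            then obtain S where S: "S \<in> sols n V" "U = S \<inter> {..<Suc k}" by (auto simp: X_def)
            then have "U \<inter> {..<k} = S \<inter> {..<k}" by auto
            then show "U \<inter> {..<k} \<in> X k" using S by (auto simp: X_def)
          qed
          \<comment> \<open>\<open>g\<close> has no coefficient beyond \<open>k\<close>, so it
            constrains the truncation \<open>U\<close> itself; as \<open>g k\<close> is nonzero, the
            part of \<open>U\<close> below \<open>k\<close> decides whether \<open>k\<close> lies in
            \<open>U\<close>.\<close>
          have eqn: "sum g (U \<inter> {..<k}) + (if k \<in> U then g k else 0) = g n" if U: "U \<in> X (Suc k)" for U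
          proof -
            obtain S where S: "S \<in> sols n V" "U = S \<inter> {..<Suc k}" using U by (auto simp: X_def)
            have sub: "S \<subseteq> {..<n}" and "sum g S = g n"
              using S g by (auto simp: sols_def leading_def)
            have "sum g S = sum g U"
              using sub g S finite_subset[OF sub]
              by (intro sum.mono_neutral_right) (auto simp: leading_def Suc_le_eq)
            also have "\<dots> = sum g ((U \<inter> {..<k}) \<union> (U \<inter> {k}))"
              using S by (intro arg_cong[where f = "sum g"]) (auto simp: lessThan_Suc)
            also have "\<dots> = sum g (U \<inter> {..<k}) + sum g (U \<inter> {k})"
              by (rule sum.union_disjoint) auto
            also have "sum g (U \<inter> {k}) = (if k \<in> U then g k else 0)"
              by simp
            finally show ?thesis using \<open>sum g S = g n\<close> by simp
          qed
          show "inj_on (\<lambda>U. U \<inter> {..<k}) (X (Suc k))"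
          proof (rule inj_onI)
            fix U U' assume U: "U \<in> X (Suc k)" "U' \<in> X (Suc k)" and eq: "U \<inter> {..<k} = U' \<inter> {..<k}"
            have "k \<in> U \<longleftrightarrow> k \<in> U'"
              using eqn[OF U(1)] eqn[OF U(2)] g(2) unfolding eq by (auto split: if_splits)
            moreover have "U \<subseteq> {..<Suc k}" "U' \<subseteq> {..<Suc k}"
              using U by (auto simp: X_def)
            ultimately show "U = U'"
              using eq unfolding lessThan_Suc by blast
          qed
        qed
        then have "card (X (Suc k)) * 2 ^ Suc j \<le> card (X k) * 2 ^ Suc j"
          by (rule mult_right_mono) auto
        also have "\<dots> \<le> 2 ^ Suc k"
          using j by simp
        finally show ?thesis .
      qed
      ultimately show ?thesis by blast
    qed
  qed
  from this[of n] obtain j' where j': "card V = CARD('a) ^ j'" "card (X n) * 2 ^ j' \<le> 2 ^ n"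
    by (auto simp: leading_self)
  have "X n = sols n V"
    by (force simp: X_def sols_def image_iff Int_absorb2)
  moreover have "CARD('a) > 1"
    using card_mono[of "UNIV :: 'a set" "{0, 1}"] by simp
  then have "j' = j"
    using card j'(1) by simp
  ultimately show ?thesis
    using j'(2) by simp
qed

section \<open>Fourier estimate\<close>

definition character :: "'p::prime_card mod_ring \<Rightarrow> complex" where
  "character a = cis (2 * pi * of_int (to_int_mod_ring a) / real CARD('p))"

lemma character_add: "character (a + b :: 'p::prime_card mod_ring) = character a * character b"
proof -
  let ?p = "int CARD('p)" and ?s = "to_int_mod_ring a + to_int_mod_ring b"
  have "to_int_mod_ring (a + b) = ?s mod ?p"
    by (transfer) simp
  also have "\<dots> = ?s - ?p * (?s div ?p)"
    by (simp add: minus_mult_div_eq_mod)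
  finally have sum: "to_int_mod_ring (a + b) = ?s - ?p * (?s div ?p)" .
  have "2 * pi * of_int (to_int_mod_ring (a + b)) / real CARD('p)
      = (2 * pi * of_int (to_int_mod_ring a) / real CARD('p)
         + 2 * pi * of_int (to_int_mod_ring b) / real CARD('p)) - 2 * pi * of_int (?s div ?p)"
    unfolding sum by (simp add: field_simps)
  then have "character (a + b) = cis (2 * pi * of_int (to_int_mod_ring a) / real CARD('p)
         + 2 * pi * of_int (to_int_mod_ring b) / real CARD('p)) / cis (2 * pi * of_int (?s div ?p))"
    unfolding character_def by (simp only: cis_divide)
  also have "cis (2 * pi * of_int (?s div ?p)) = 1"
    by (rule cis_multiple_2pi) simp
  finally show ?thesis
    by (simp add: character_def cis_mult)
qed

lemma character_0 [simp]: "character 0 = 1"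
  by (simp add: character_def)

lemma norm_character [simp]: "norm (character a) = 1"
  by (simp add: character_def)

lemma character_sum: "character (sum f A) = (\<Prod>i\<in>A. character (f i))"
  by (induction A rule: infinite_finite_induct) (simp_all add: character_add)

lemma character_eq_1_iff: "character (a :: 'p::prime_card mod_ring) = 1 \<longleftrightarrow> a = 0"
proof
  assume "character a = 1"
  then have "cos (2 * pi * of_int (to_int_mod_ring a) / real CARD('p)) = 1"
    by (simp add: character_def complex_eq_iff)
  then obtain k :: int where "2 * pi * of_int (to_int_mod_ring a) / real CARD('p) = k * 2 * pi"
    unfolding cos_one_2pi_int by auto
  then have "real_of_int (to_int_mod_ring a) = real_of_int (int CARD('p) * k)"
    by (simp add: field_simps)
  then have "to_int_mod_ring a = int CARD('p) * k"
    by (simp only: of_int_eq_iff)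
  moreover have "to_int_mod_ring a \<in> {0..<int CARD('p)}"
    using range_to_int_mod_ring by blast
  ultimately have "to_int_mod_ring a = 0"
    by (metis atLeastLessThan_iff mod_mult_self1_is_0 mod_pos_pos_trivial)

  then show "a = 0" by simp
qed simp

text \<open>On the unit circle the square of \<open>norm (1 + z)\<close> is
  \<open>2 + 2 * Re z\<close>, and \<open>Re z = 1\<close> only for \<open>z = 1\<close>.\<close>

lemma norm_one_plus_character:
  assumes "a \<noteq> (0 :: 'p::prime_card mod_ring)" shows "norm (1 + character a) < 2"
proof -
  have "character a \<noteq> 1" using assms by (simp add: character_eq_1_iff)
  moreover have unit: "(Re (character a))\<^sup>2 + (Im (character a))\<^sup>2 = 1"
    using norm_character[of a] cmod_power2[of "character a"] by simp
  then have "Re (character a) \<le> 1"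
    using complex_Re_le_cmod[of "character a"] by simp
  ultimately have "Re (character a) < 1"
    using unit by (cases "Re (character a) = 1") (auto simp: complex_eq_iff)
  have "(norm (1 + character a))\<^sup>2 = 2 + 2 * Re (character a)"
    using unit unfolding cmod_power2 by (simp add: power2_eq_square algebra_simps)
  also have "\<dots> < 2\<^sup>2"
    using \<open>Re (character a) < 1\<close> by simp
  finally show ?thesis
    by (rule power2_less_imp_less) simp
qed

lemma character_contraction:
  "\<exists>\<gamma>>0. \<gamma> < 1 \<and> (\<forall>a::'p::prime_card mod_ring. a \<noteq> 0 \<longrightarrow> norm (1 + character a) \<le> 2 * \<gamma>)"
proof -
  \<comment> \<open>The entry \<open>1 / 2\<close> makes the maximum positive; over the field with
    two elements the only other entry is 0.\<close>
  let ?X = "insert (1 / 2) ((\<lambda>a::'p mod_ring. norm (1 + character a) / 2) ` (UNIV - {0}))"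
  have bound: "x < 1" if "x \<in> ?X" for x
  proof -
    from that consider "x = 1 / 2" | a :: "'p mod_ring" where "a \<noteq> 0" "x = norm (1 + character a) / 2"
      by blast
    then show ?thesis
    proof cases
      case 2
      then show ?thesis using norm_one_plus_character[OF 2(1)] by simp
    qed simp
  qed
  have "Max ?X \<in> ?X"
    by (rule Max_in) auto
  then have "Max ?X < 1" by (rule bound)
  moreover have "1 / 2 \<le> Max ?X"
    by (rule Max_ge) auto
  moreover have "norm (1 + character a) \<le> 2 * Max ?X" if "a \<noteq> 0" for a :: "'p mod_ring"
  proof -
    have "norm (1 + character a) / 2 \<le> Max ?X"
      by (rule Max_ge) (use that in auto)
    then show ?thesis by simp
  qed
  ultimately show ?thesis
    by (intro exI[of _ "Max ?X"]) auto
qed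

text \<open>Orthogonality: translation by a violated equation \<open>g\<close> multiplies the sum by
  a character value different from 1.\<close>

lemma sum_character_eq_space:
  fixes V :: "(nat \<Rightarrow> 'p::prime_card mod_ring) set"
  assumes V: "eq_space V"
  shows "(\<Sum>e\<in>V. character (sum e S - e n))
    = (if \<forall>e\<in>V. sum e S = e n then of_nat (card V) else 0)"
proof (cases "\<forall>e\<in>V. sum e S = e n")
  case True
  then show ?thesis by simp
next
  case False
  then obtain g where g: "g \<in> V" "sum g S \<noteq> g n" by auto
  let ?B = "\<Sum>e\<in>V. character (sum e S - e n)"
  have "?B = (\<Sum>e\<in>V. character (sum (\<lambda>i. e i + 1 * g i) S - (e n + 1 * g n)))"
    by (rule sum.reindex_bij_witness[where i = "\<lambda>e i. e i + 1 * g i" and j = "\<lambda>e i. e i - 1 * g i"])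
       (use eq_space_lincomb[OF V _ g(1), of _ 1] eq_space_diff[OF V _ g(1), of _ 1] in auto)
  also have "\<dots> = (\<Sum>e\<in>V. character (sum g S - g n) * character (sum e S - e n))"
    by (intro sum.cong refl) (simp add: sum.distrib character_add[symmetric] algebra_simps)
  also have "\<dots> = character (sum g S - g n) * ?B"
    by (simp add: sum_distrib_left)
  finally have "(1 - character (sum g S - g n)) * ?B = 0"
    by (simp add: algebra_simps)
  moreover have "character (sum g S - g n) \<noteq> 1"
    using g by (simp add: character_eq_1_iff)
  ultimately have "?B = 0" by simp
  then show ?thesis by (simp only: False if_False)
qed

lemma card_sols_character:
  fixes V :: "(nat \<Rightarrow> 'p::prime_card mod_ring) set"
  assumes V: "eq_space V"
  shows "of_nat (card V * card (sols n V)) = (\<Sum>e\<in>V. \<Sum>S\<in>Pow {..<n}. character (sum e S - e n))"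
proof -
  have "(\<Sum>e\<in>V. \<Sum>S\<in>Pow {..<n}. character (sum e S - e n))
      = (\<Sum>S\<in>Pow {..<n}. if \<forall>e\<in>V. sum e S = e n then of_nat (card V) else 0)"
    by (subst sum.swap) (simp only: sum_character_eq_space[OF V])
  also have "\<dots> = (\<Sum>S\<in>sols n V. of_nat (card V))"
    by (intro sum.mono_neutral_cong_right) (auto simp: sols_def)
  finally show ?thesis by (simp add: mult.commute)
qed

text \<open>The sum factors over the variables; a nonzero coefficient contributes at most
  \<open>2 * \<gamma>\<close>, a zero coefficient 2.\<close>

lemma norm_cube_character_sum:
  fixes e :: "nat \<Rightarrow> 'p::prime_card mod_ring"
  assumes "0 < \<gamma>" and contr: "\<And>a::'p mod_ring. a \<noteq> 0 \<Longrightarrow> norm (1 + character a) \<le> 2 * \<gamma>"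
  shows "norm (\<Sum>S\<in>Pow {..<n}. character (sum e S - e n)) \<le> 2 ^ n * \<gamma> ^ wt n e"
proof -
  have "(\<Sum>S\<in>Pow {..<n}. character (sum e S - e n))
      = (\<Sum>S\<in>Pow {..<n}. character (- e n) * (\<Prod>i\<in>S. character (e i)))"
    by (intro sum.cong refl) (simp add: character_sum[symmetric] character_add[symmetric])
  also have "\<dots> = character (- e n) * (\<Prod>i<n. character (e i) + 1)"
    by (simp add: prod_add sum_distrib_left)
  finally have "norm (\<Sum>S\<in>Pow {..<n}. character (sum e S - e n)) = (\<Prod>i<n. norm (1 + character (e i)))"
    by (simp add: norm_mult prod_norm add.commute)
  also have "\<dots> \<le> (\<Prod>i<n. 2 * (if e i \<noteq> 0 then \<gamma> else 1))"
    by (intro prod_mono) (use contr in auto)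
  also have "\<dots> = 2 ^ n * (\<Prod>i\<in>{i\<in>{..<n}. e i \<noteq> 0}. \<gamma>)"
    unfolding prod.distrib prod.inter_filter[OF finite_lessThan] by simp
  also have "\<dots> = 2 ^ n * \<gamma> ^ wt n e"
    by (simp add: wt_def)
  finally show ?thesis .
qed

text \<open>Counting solutions of \<open>V\<close> with characters, the elements of \<open>T\<close> contribute the solutions of \<open>T\<close>
  and the heavy remaining ones only an error term.\<close>

lemma sols_extend:
  fixes V T :: "(nat \<Rightarrow> 'p::prime_card mod_ring) set"
  assumes \<gamma>: "0 < \<gamma>" "\<gamma> < 1" "\<And>a::'p mod_ring. a \<noteq> 0 \<Longrightarrow> norm (1 + character a) \<le> 2 * \<gamma>"
    and V: "eq_space V" and T: "eq_space T" "T \<subseteq> V"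
    and heavy: "\<And>e. e \<in> V - T \<Longrightarrow> w \<le> wt n e"
    and large: "real (card V) * 2 ^ n * \<gamma> ^ w < real (card T * card (sols n T))"
  shows "sols n V \<noteq> {}"
proof
  assume empty: "sols n V = {}"
  let ?B = "\<lambda>e::nat \<Rightarrow> 'p mod_ring. \<Sum>S\<in>Pow {..<n}. character (sum e S - e n)"
  have fin: "finite V" using V by (rule finite_eq_space)
  \<comment> \<open>Without solutions the whole character sum is 0, so the share of
    \<open>T\<close>, which counts its solutions, is cancelled by the heavy elements.\<close>
  have "0 = (\<Sum>e\<in>V. ?B e)"
    using card_sols_character[OF V, of n] empty by simp
  also have "\<dots> = (\<Sum>e\<in>V - T. ?B e) + (\<Sum>e\<in>T. ?B e)"
    by (rule sum.subset_diff[OF T(2) fin])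
  finally have "(\<Sum>e\<in>T. ?B e) = - (\<Sum>e\<in>V - T. ?B e)"
    by (simp add: eq_neg_iff_add_eq_0 add.commute)
  then have "norm (of_nat (card T * card (sols n T)) :: complex) = norm (\<Sum>e\<in>V - T. ?B e)"
    unfolding card_sols_character[OF T(1)] by simp
  also have "\<dots> \<le> (\<Sum>e\<in>V - T. 2 ^ n * \<gamma> ^ w)"
  proof (rule sum_norm_le)
    fix e assume "e \<in> V - T"
    have "norm (?B e) \<le> 2 ^ n * \<gamma> ^ wt n e"
      using \<gamma> by (intro norm_cube_character_sum) auto
    also have "\<dots> \<le> 2 ^ n * \<gamma> ^ w"
      using \<gamma> heavy[OF \<open>e \<in> V - T\<close>] by (intro mult_left_mono power_decreasing) auto
    finally show "norm (?B e) \<le> 2 ^ n * \<gamma> ^ w" .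
  qed
  also have "\<dots> = real (card (V - T)) * (2 ^ n * \<gamma> ^ w)"
    by simp
  also have "\<dots> \<le> real (card V) * (2 ^ n * \<gamma> ^ w)"
    using \<gamma> fin by (intro mult_right_mono) (auto intro: card_mono)
  finally show False
    using large by (simp only: norm_of_nat mult.assoc)
qed

section \<open>Safe positions\<close>

text \<open>A contradiction involving a nonzero multiple of \<open>f\<close> could be solved for
  \<open>f\<close>, giving an equation for \<open>f\<close> inside \<open>V\<close>.\<close>

lemma consistent_adjoin:
  fixes V :: "(nat \<Rightarrow> 'a::field) set"
  assumes V: "eq_space V" and cons: "consistent n V"
    and f: "\<forall>i>n. f i = 0" and new: "\<forall>a. f(n := a) \<notin> V"
  shows "consistent n (adjoin (f(n := a)) V)"
  unfolding consistent_def
proof (intro ballI conjI impI)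
  fix e assume "e \<in> adjoin (f(n := a)) V"
  then obtain v c where v: "v \<in> V" "e = (\<lambda>i. v i + c * (f(n := a)) i)"
    by (rule adjoinE)
  have v0: "\<forall>i>n. v i = 0"
    using cons v by (auto simp: consistent_def)
  then show "\<forall>i>n. e i = 0"
    using f v by simp
  assume z: "\<forall>i<n. e i = 0"
  have "c = 0"
  proof (rule ccontr)
    assume c: "c \<noteq> 0"
    have "f(n := - (1 / c) * v n) = (\<lambda>i. - (1 / c) * v i)"
    proof
      fix i
      show "(f(n := - (1 / c) * v n)) i = - (1 / c) * v i"
      proof (cases i n rule: linorder_cases)
        case less
        then have "v i + c * f i = 0" using z v by auto
        then show ?thesis using c less by (simp add: field_simps eq_neg_iff_add_eq_0)
      qed (use f v0 in auto)
    qed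
    then show False
      using new eq_space_scale[OF V v(1), of "- (1 / c)"] by metis
  qed
  then show "e n = 0"
    using z v cons by (auto simp: consistent_def)
qed

lemma disjoint_card_le:
  fixes T U V :: "(nat \<Rightarrow> 'a::field) set"
  assumes T: "eq_space T" "T \<subseteq> V" and U: "eq_space U" "U \<subseteq> V" and V: "eq_space V"
    and disj: "T \<inter> U \<subseteq> {\<lambda>_. 0}"
  shows "card T * card U \<le> card V"
proof -
  have "card (T \<times> U) \<le> card V"
  proof (rule card_inj_on_le[where f = "\<lambda>(t, u) i. t i + 1 * u i"])
    show "inj_on (\<lambda>(t, u) i. t i + 1 * u i) (T \<times> U)"
    proof (rule inj_onI, clarsimp)
      fix t u t' u' assume *: "t \<in> T" "u \<in> U" "t' \<in> T" "u' \<in> U"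
        and eq: "(\<lambda>i. t i + u i) = (\<lambda>i. t' i + u' i)"
      have eq': "t i + u i = t' i + u' i" for i using fun_cong[OF eq, of i] .
      have "(\<lambda>i. t i - 1 * t' i) = (\<lambda>i. u' i - 1 * u i)"
        using eq' by (auto simp: fun_eq_iff algebra_simps)
      then have "(\<lambda>i. t i - 1 * t' i) \<in> T \<inter> U"
        using eq_space_diff[OF T(1) *(1,3), of 1] eq_space_diff[OF U(1) *(4,2), of 1] by simp
      then have "t i = t' i" for i
        using disj by (auto simp: fun_eq_iff)
      then show "t = t' \<and> u = u'" using eq' by (auto simp: fun_eq_iff)
    qed
    show "(\<lambda>(t, u) i. t i + 1 * u i) ` (T \<times> U) \<subseteq> V"
      using eq_space_lincomb[OF V, of _ _ 1] T(2) U(2) by auto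
  qed (use V finite_eq_space in auto)
  then show ?thesis by (simp add: card_cartesian_product)
qed

text \<open>\<open>W0\<close> is spanned by the equations of the system, whose forms all have large weight; weights up
  to \<open>w\<close> count as light, and \<open>M\<close> bounds the number of equations not implied by earlier ones.\<close>

locale delayer =
  fixes n w h p M :: nat and \<gamma> :: real and W0 :: "(nat \<Rightarrow> 'p::prime_card mod_ring) set"
  assumes p: "p = CARD('p)" and M: "M = p * h"
    and \<gamma>: "0 < \<gamma>" "\<gamma> < 1" "\<And>a::'p mod_ring. a \<noteq> 0 \<Longrightarrow> norm (1 + character a) \<le> 2 * \<gamma>"
    and W0: "eq_space W0"
    and heavy: "\<And>e. e \<in> W0 \<Longrightarrow> e \<noteq> (\<lambda>_. 0) \<Longrightarrow> 2 * w * M < wt n e"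
    and small: "real (p ^ M * 2 ^ (p * M)) * \<gamma> ^ w < 1"
begin

lemma p_gt_1: "1 < p"
  using prime_gt_1_nat[OF prime_card[where 'a = 'p]] by (simp add: p)

text \<open>\<open>T\<close> stands for a span of \<open>j\<close> independent elements of weight at
  most \<open>2 * w\<close>, of which only the dimension and the resulting weight bound are kept.
  \<open>E\<close> may be smaller than a basis: equations implied on the cube can be left
  out.\<close>

definition tracked :: "(nat \<Rightarrow> 'p mod_ring) set \<Rightarrow> nat \<Rightarrow> (nat \<Rightarrow> 'p mod_ring) set \<Rightarrow> (nat \<Rightarrow> 'p mod_ring) set \<Rightarrow> bool" where
  "tracked W j T E \<longleftrightarrow> eq_space T \<and> T \<subseteq> W \<and> card T = p ^ j \<and>
     (\<forall>e\<in>T. wt n e \<le> j * (2 * w)) \<and> finite E \<and> sols n T = sols n E"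

definition extends :: "nat \<Rightarrow> (nat \<Rightarrow> 'p mod_ring) set \<Rightarrow> bool" where
  "extends D W \<longleftrightarrow> eq_space W \<and> consistent n W \<and> W0 \<subseteq> W \<and> card W = p ^ D * card W0"

text \<open>\<open>W\<close> is the span of the position and \<open>D\<close> its dimension over \<open>W0\<close>; of the \<open>D\<close> equations that were
  not determined when added, \<open>m\<close> come from branching points. The space \<open>T\<close> has the same Boolean
  solutions as the equations \<open>E\<close>, hence at least \<open>s\<close> fewer equations suffice than its dimension \<open>j\<close>;
  comparing lower and upper bounds for the number of solutions bounds \<open>s\<close> in terms of \<open>m\<close>.\<close>

definition safe :: "(nat \<Rightarrow> 'p mod_ring) set \<Rightarrow> nat \<Rightarrow> bool" where
  "safe W m \<longleftrightarrow> (\<exists>D s T j E. extends D W \<and> D = s + m \<and> tracked W j T E \<and>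
     (\<forall>e\<in>W. wt n e \<le> w \<longrightarrow> e \<in> T) \<and> sols n T \<noteq> {} \<and> card E + s \<le> j \<and> j \<le> D)"

lemma tracked_adjoin:
  assumes t: "tracked W j T E" and W: "eq_space W" "g \<in> W" "g \<notin> T" and wt: "wt n g \<le> 2 * w"
    and E: "finite E'" "sols n (adjoin g T) = sols n E'"
  shows "tracked W (Suc j) (adjoin g T) E'"
  unfolding tracked_def
proof (intro conjI ballI)
  from t have T: "eq_space T" "T \<subseteq> W" "card T = p ^ j" "\<And>e. e \<in> T \<Longrightarrow> wt n e \<le> j * (2 * w)"
    by (auto simp: tracked_def)
  show "eq_space (adjoin g T)" by (rule eq_space_adjoin[OF T(1)])
  show "adjoin g T \<subseteq> W" using W T by (intro adjoin_subset) auto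
  show "card (adjoin g T) = p ^ Suc j"
    using card_adjoin[OF T(1) W(3)] T by (simp add: p)
  fix e assume "e \<in> adjoin g T"
  then obtain v c where v: "v \<in> T" "e = (\<lambda>i. v i + c * g i)"
    by (rule adjoinE)
  show "wt n e \<le> Suc j * (2 * w)"
    using wt_lincomb[of n v c g] T(4)[OF v(1)] wt by (simp add: v(2))
qed (use E in auto)

text \<open>Elements of \<open>T\<close> weigh at most \<open>2 * w * M\<close>, too little for a
  nonzero element of \<open>W0\<close>, so \<open>T\<close> and \<open>W0\<close> are independent
  inside \<open>W\<close>.\<close>

lemma tracked_dim_le:
  assumes W: "extends D W" and t: "tracked W j T E" and j: "j \<le> M"
  shows "j \<le> D"
proof -
  from t have T: "eq_space T" "T \<subseteq> W" "card T = p ^ j" "\<And>e. e \<in> T \<Longrightarrow> wt n e \<le> j * (2 * w)"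
    by (auto simp: tracked_def)
  have "e = (\<lambda>_. 0)" if e: "e \<in> T" "e \<in> W0" for e
  proof (rule ccontr)
    assume "e \<noteq> (\<lambda>_. 0)"
    then have "2 * w * M < j * (2 * w)"
      using heavy[OF e(2)] T(4)[OF e(1)] by linarith
    moreover have "j * (2 * w) \<le> M * (2 * w)"
      using j by (rule mult_right_mono) simp
    ultimately show False by (simp add: ac_simps)
  qed
  then have "p ^ j * card W0 \<le> p ^ D * card W0"
    using disjoint_card_le[OF T(1,2) W0] W T(3) by (auto simp: extends_def)
  moreover have "card W0 > 0"
    using W0 finite_eq_space zero_in_eq_space card_gt_0_iff by blast
  ultimately have "p ^ j \<le> p ^ D" by simp
  then show ?thesis
    using p_gt_1 power_le_imp_le_exp by blast
qed

text \<open>A space spanned by at most \<open>D + 1\<close> elements of weight at most \<open>2 * w\<close> meets \<open>W0\<close> trivially, so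
  adding light elements stops after at most \<open>D\<close> steps.\<close>

lemma saturate:
  assumes W: "extends D W" and D: "Suc D \<le> M" and t: "tracked W j T E" and j: "j \<le> D"
  shows "\<exists>T' j' E'. tracked W j' T' E' \<and> T \<subseteq> T' \<and> j' \<le> D \<and> card E' + j \<le> card E + j' \<and>
    (\<forall>e\<in>W. wt n e \<le> 2 * w \<longrightarrow> e \<in> T')"
  using t j
proof (induction "D - j" arbitrary: j T E rule: less_induct)
  case less
  show ?case
  proof (cases "\<forall>e\<in>W. wt n e \<le> 2 * w \<longrightarrow> e \<in> T")
    case True
    then show ?thesis using less.prems by blast
  next
    case False
    then obtain g where g: "g \<in> W" "wt n g \<le> 2 * w" "g \<notin> T" by auto
    have T: "eq_space T" "finite E" "sols n T = sols n E"
      using less.prems by (auto simp: tracked_def)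
    \<comment> \<open>\<open>g\<close> joins \<open>E\<close> too, so \<open>E\<close> grows no
      faster than the dimension and the surplus \<open>s\<close> of a safe position
      survives.\<close>
    have t': "tracked W (Suc j) (adjoin g T) (insert g E)"
      using less.prems W g T
      by (intro tracked_adjoin) (auto simp: extends_def sols_adjoin sols_insert)
    \<comment> \<open>The spare unit in \<open>Suc D \<le> M\<close> makes the dimension bound
      applicable to \<open>Suc j\<close>.\<close>
    have "Suc j \<le> D"
      using tracked_dim_le[OF W t'] less.prems D by simp
    then have "D - Suc j < D - j" by simp
    from less.hyps[OF this t' \<open>Suc j \<le> D\<close>] obtain T' j' E' where *: "tracked W j' T' E'"
      "adjoin g T \<subseteq> T'" "j' \<le> D" "card E' + Suc j \<le> card (insert g E) + j'"
      "\<forall>e\<in>W. wt n e \<le> 2 * w \<longrightarrow> e \<in> T'"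
      by blast
    moreover have "card (insert g E) \<le> Suc (card E)"
      by (rule card_insert_le_m1) simp_all
    moreover have "T \<subseteq> T'"
      using * adjoin_base by blast
    ultimately show ?thesis
      by (intro exI[of _ T'] exI[of _ j'] exI[of _ E']) auto
  qed
qed

lemma small_power:
  assumes "0 < N" "a \<le> M" "b \<le> p * M"
  shows "real (p ^ a * 2 ^ b * N) * \<gamma> ^ w < real N"
proof -
  have "real (p ^ a * 2 ^ b * N) * \<gamma> ^ w \<le> real (p ^ M * 2 ^ (p * M) * N) * \<gamma> ^ w"
    using assms p_gt_1 \<gamma> by (intro mult_right_mono of_nat_mono mult_mono power_increasing) auto
  also have "\<dots> = (real (p ^ M * 2 ^ (p * M)) * \<gamma> ^ w) * real N"
    by simp
  also have "\<dots> < 1 * real N"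
    using small assms by (intro mult_strict_right_mono) auto
  finally show ?thesis by simp
qed

text \<open>The Fourier estimate applies to \<open>T\<close> inside \<open>T'\<close>: all light
  elements are in \<open>T\<close> already, and Warning's theorem gives \<open>T\<close> so many
  solutions that the error cannot cancel them.\<close>

lemma sols_saturated:
  assumes t: "tracked W j T E" and t': "tracked W j' T' E'" and sub: "T \<subseteq> T'"
    and light: "\<forall>e\<in>W. wt n e \<le> w \<longrightarrow> e \<in> T" and ne: "sols n T \<noteq> {}"
    and bounds: "j' \<le> M" "card E \<le> M"
  shows "sols n T' \<noteq> {}"
proof -
  from t have T: "eq_space T" "finite E" "sols n T = sols n E" by (auto simp: tracked_def)
  from t' have T': "eq_space T'" "T' \<subseteq> W" "card T' = p ^ j'" by (auto simp: tracked_def)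
  let ?N = "card (sols n T)"
  have N: "0 < ?N" using ne by (simp add: card_gt_0_iff finite_sols)
  have "2 ^ n \<le> ?N * 2 ^ ((p - 1) * card E)"
    using warning_sols[OF T(2), of n] ne unfolding T(3) by (simp add: p)
  then have "real (card T' * 2 ^ n) * \<gamma> ^ w \<le> real (card T' * (?N * 2 ^ ((p - 1) * card E))) * \<gamma> ^ w"
    using \<gamma> by (intro mult_right_mono of_nat_mono mult_left_mono) auto
  also have "\<dots> = real (p ^ j' * 2 ^ ((p - 1) * card E) * ?N) * \<gamma> ^ w"
    unfolding T'(3) by simp
  also have "\<dots> < real ?N"
    using N bounds by (intro small_power mult_mono) auto
  also have "\<dots> \<le> real (card T * ?N)"
    using finite_eq_space[OF T(1)] zero_in_eq_space[OF T(1)]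
    by (intro of_nat_mono) (auto simp: Suc_le_eq card_gt_0_iff)
  finally have "real (card T') * 2 ^ n * \<gamma> ^ w < real (card T * ?N)"
    by simp
  moreover have "w \<le> wt n e" if "e \<in> T' - T" for e
    using that light T'(2) by (meson DiffE nat_le_linear subsetD)
  ultimately show ?thesis
    using T(1) T'(1) sub \<gamma> by (intro sols_extend[of \<gamma> T' T w n]) auto
qed

text \<open>The Fourier estimate over the zero space: all nonzero elements of the span of
  \<open>f = a\<close> are heavy. Its size \<open>p\<close> is covered because \<open>0 < h\<close>
  gives \<open>1 \<le> M\<close>.\<close>

lemma heavy_form_values:
  fixes f :: "nat \<Rightarrow> 'p mod_ring"
  assumes "w < wt n f" "0 < h"
  shows "\<exists>S\<subseteq>{..<n}. sum f S = a"
proof -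
  let ?z = "{\<lambda>_. 0 :: 'p mod_ring}"
  let ?V = "adjoin (f(n := a)) ?z"
  have fn: "wt n (f(n := a)) = wt n f" by (rule wt_cong) simp
  then have "f(n := a) \<notin> ?z"
    using assms by (auto simp: wt_eq_0_iff[symmetric] fun_eq_iff)
       (metis fun_upd_other gr_implies_not_zero nless_le wt_eq_0_iff)
  then have card: "card ?V = p"
    by (simp add: card_adjoin[OF eq_space_zero] p)
  have "sols n ?V \<noteq> {}"
  proof (rule sols_extend[OF \<gamma>(1-3) eq_space_adjoin[OF eq_space_zero] eq_space_zero adjoin_base])
    fix e assume "e \<in> ?V - ?z"
    then obtain v c where "v \<in> ?z" "e = (\<lambda>i. v i + c * (f(n := a)) i)" "e \<notin> ?z"
      by (auto elim!: adjoinE)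
    then have "e = (\<lambda>i. c * (f(n := a)) i)" "c \<noteq> 0"
      by auto
    then show "w \<le> wt n e"
      using wt_scale[of c n "f(n := a)"] assms fn by simp
  next
    have "sols n ?z = Pow {..<n}" by (auto simp: sols_def)
    then have 1: "card ?z * card (sols n ?z) = 2 ^ n" by (simp add: card_Pow)
    have "real (p ^ 1 * 2 ^ 0 * 2 ^ n) * \<gamma> ^ w < real (2 ^ n)"
      using assms p_gt_1 by (intro small_power) (auto simp: M)
    then show "real (card ?V) * 2 ^ n * \<gamma> ^ w < real (card ?z * card (sols n ?z))"
      unfolding 1 card by simp
  qed auto
  then obtain S where S: "S \<subseteq> {..<n}" "sum (f(n := a)) S = a"
    using adjoin_new[OF eq_space_zero, of "f(n := a)"] by (force simp: sols_def)
  moreover have "sum (f(n := a)) S = sum f S"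
    using S by (intro sum.cong) auto
  ultimately show ?thesis by auto
qed

text \<open>Dimension \<open>j\<close> allows at most \<open>2 ^ (n - j)\<close> solutions, whereas
  \<open>card E\<close> equations leave at least \<open>2 ^ (n - (p - 1) * card E)\<close>. Hence
  \<open>j\<close> is at most \<open>(p - 1) * card E\<close>, and \<open>card E\<close> is at most
  \<open>m\<close>.\<close>

lemma tracked_dim_bound:
  assumes t: "tracked W j T E" and ne: "sols n T \<noteq> {}" and "consistent n W"
    and "card E + s \<le> j" "j \<le> s + m"
  shows "s + m \<le> p * m"
proof -
  from t have T: "eq_space T" "T \<subseteq> W" "card T = p ^ j" "finite E" "sols n T = sols n E"
    by (auto simp: tracked_def)
  have N: "0 < card (sols n T)" using ne by (simp add: card_gt_0_iff finite_sols)
  have "card (sols n T) * 2 ^ j \<le> 2 ^ n"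
    using T consistent_subset[OF assms(3) T(2)] by (intro card_sols_le) (auto simp: p)
  also have "\<dots> \<le> card (sols n T) * 2 ^ ((p - 1) * card E)"
    using warning_sols[OF T(4), of n] ne unfolding T(5) by (simp add: p)
  finally have "(2::nat) ^ j \<le> 2 ^ ((p - 1) * card E)"
    using N by simp
  then have "j \<le> (p - 1) * card E"
    by simp
  also have "\<dots> \<le> (p - 1) * m"
    using assms by (intro mult_left_mono) auto
  finally have "s \<le> (p - 1) * m" using assms by simp
  moreover have "m \<le> p * m"
    using p_gt_1 by simp
  ultimately show ?thesis
    unfolding diff_mult_distrib by linarith
qed

section \<open>Preserving safety in one round\<close>

lemma extends_adjoin:
  assumes W: "extends D W" and f: "\<forall>i>n. f i = 0" and new: "\<forall>a. f(n := a) \<notin> W"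
  shows "extends (Suc D) (adjoin (f(n := a)) W)"
proof -
  have *: "eq_space W" "consistent n W" "W0 \<subseteq> W" "card W = p ^ D * card W0"
    using W by (auto simp: extends_def)
  have "card (adjoin (f(n := a)) W) = p ^ Suc D * card W0"
    using card_adjoin[OF *(1), of "f(n := a)"] new *(4) by (simp add: p)
  moreover have "W0 \<subseteq> adjoin (f(n := a)) W"
    using *(3) adjoin_base by blast
  ultimately show ?thesis
    unfolding extends_def using eq_space_adjoin[OF *(1)] consistent_adjoin[OF *(1,2) f new] by blast
qed

text \<open>Modulo \<open>W\<close> the form \<open>f\<close> is the light form \<open>g\<close>,
  and \<open>a\<close> is chosen so that \<open>S\<close> satisfies the resulting equation for
  \<open>g\<close>. \<open>E'\<close>, \<open>s\<close> and \<open>m\<close> stay open to serve both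
  uses: an implied equation raises \<open>s\<close>, a branching point raises
  \<open>m\<close>.\<close>

lemma safe_light:
  fixes f u :: "nat \<Rightarrow> 'p mod_ring" and E' :: "(nat \<Rightarrow> 'p mod_ring) set"
  defines "g \<equiv> \<lambda>i. f i + u i"
  assumes W: "extends D W" and t: "tracked W j T E"
    and sat: "\<forall>e\<in>W. wt n e \<le> 2 * w \<longrightarrow> e \<in> T"
    and f: "\<forall>i>n. f i = 0" and new: "\<forall>a. f(n := a) \<notin> W"
    and u: "u \<in> W" and light: "wt n g \<le> w"
    and S: "S \<in> sols n T" and a: "a = sum g S - u n"
    and E': "finite E'" "sols n E' = {U \<in> sols n T. sum g U = sum g S}"
    and bounds: "card E' + s \<le> Suc j" "j \<le> D" "Suc D = s + m"
  shows "safe (adjoin (f(n := a)) W) m"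
proof -
  let ?W = "adjoin (f(n := a)) W"
  define g' where "g' = (\<lambda>i. (f(n := a)) i + u i)"
  have g': "g' i = g i" if "i < n" for i
    using that by (simp add: g'_def g_def)
  have g'n: "g' n = sum g S"
    by (simp add: g'_def a)
  have W': "eq_space W" using W by (simp add: extends_def)
  have T: "eq_space T" "T \<subseteq> W" using t by (auto simp: tracked_def)
  have eW: "eq_space ?W" by (rule eq_space_adjoin[OF W'])
  have f'W: "f(n := a) \<in> ?W" by (rule adjoin_new[OF W'])
  have g'W: "g' \<in> ?W"
    using adjoinI[OF u, of 1 "f(n := a)"] by (simp add: g'_def add.commute)
  have sumg': "sum g' U = sum g U" if "U \<in> sols n T" for U
    using that g' by (intro sum.cong) (auto simp: sols_def)
  have solsE': "sols n (adjoin g' T) = sols n E'"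
    using sumg' by (auto simp: sols_adjoin[OF T(1)] E'(2) g'n)
  have "g' \<notin> T"
  proof
    assume "g' \<in> T"
    then have "(\<lambda>i. g' i - 1 * u i) \<in> W" using T(2) u by (intro eq_space_diff[OF W']) auto
    moreover have "(\<lambda>i. g' i - 1 * u i) = f(n := a)"
      by (auto simp: g'_def)
    ultimately show False using new by metis
  qed
  moreover have wtg': "wt n g' \<le> w"
    using light wt_cong[of n g' g] g' by simp
  moreover have "tracked ?W j T E"
    using t adjoin_base unfolding tracked_def by blast
  ultimately have tr: "tracked ?W (Suc j) (adjoin g' T) E'"
    using eW g'W E'(1) solsE' by (intro tracked_adjoin) auto
  \<comment> \<open>A light element of the new span is a multiple of \<open>g'\<close> plus an
    element of \<open>W\<close> of weight at most \<open>2 * w\<close>, which explains why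
    \<open>T\<close> is saturated up to \<open>2 * w\<close> and not just \<open>w\<close>.\<close>
  have "e \<in> adjoin g' T" if e: "e \<in> ?W" "wt n e \<le> w" for e
  proof -
    obtain v c where v: "v \<in> W" "e = (\<lambda>i. v i + c * (f(n := a)) i)"
      using e(1) by (rule adjoinE)
    define v' where "v' = (\<lambda>i. v i - c * u i)"
    have v'W: "v' \<in> W" unfolding v'_def by (rule eq_space_diff[OF W' v(1) u])
    have e': "e = (\<lambda>i. v' i + c * g' i)"
      by (simp add: v(2) v'_def g'_def algebra_simps)
    then have "v' = (\<lambda>i. e i - c * g' i)" by simp
    then have "wt n v' \<le> 2 * w"
      using wt_diff[of n e c g'] e(2) wtg' by simp
    then have "v' \<in> T" using sat v'W by blast
    then show ?thesis unfolding e' by (rule adjoinI)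
  qed
  moreover have "S \<in> sols n (adjoin g' T)"
    using S by (simp add: solsE' E'(2))
  ultimately show ?thesis
    unfolding safe_def using extends_adjoin[OF W f new, of a] tr bounds
    by (intro exI[of _ "Suc D"] exI[of _ s] exI[of _ "adjoin g' T"] exI[of _ "Suc j"] exI[of _ E'])
       auto
qed

text \<open>Elements of the new span outside \<open>W\<close> are multiples of elements of the coset
  of \<open>f\<close>, all heavy, so \<open>T\<close> and \<open>E\<close> serve unchanged for every
  value \<open>a\<close>.\<close>

lemma safe_heavy:
  assumes W: "extends D W" and t: "tracked W j T E"
    and light: "\<forall>e\<in>W. wt n e \<le> w \<longrightarrow> e \<in> T" and ne: "sols n T \<noteq> {}"
    and f: "\<forall>i>n. f i = 0" and new: "\<forall>a. f(n := a) \<notin> W"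
    and heavy: "\<forall>u\<in>W. w < wt n (\<lambda>i. f i + u i)"
    and bounds: "card E + s \<le> j" "j \<le> D" "D = s + m"
  shows "safe (adjoin (f(n := a)) W) (Suc m)"
proof -
  let ?W = "adjoin (f(n := a)) W"
  have W': "eq_space W" using W by (simp add: extends_def)
  have "tracked ?W j T E"
    using t adjoin_base unfolding tracked_def by blast
  moreover have "e \<in> T" if e: "e \<in> ?W" "wt n e \<le> w" for e
  proof -
    obtain v c where v: "v \<in> W" "e = (\<lambda>i. v i + c * (f(n := a)) i)"
      using e(1) by (rule adjoinE)
    show ?thesis
    proof (cases "c = 0")
      case True
      then show ?thesis using v e light by simp
    next
      case False
      have "wt n e = wt n (\<lambda>i. c * (f i + (1 / c) * v i))"
        using False by (intro wt_cong) (simp add: v(2) algebra_simps)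
      also have "\<dots> = wt n (\<lambda>i. f i + (1 / c) * v i)"
        using False by (rule wt_scale)
      also have "\<dots> > w"
        using bspec[OF heavy eq_space_scale[OF W' v(1), of "1 / c"]] .
      finally show ?thesis using e by simp
    qed
  qed
  ultimately show ?thesis
    unfolding safe_def using extends_adjoin[OF W f new, of a] ne bounds
    by (intro exI[of _ "Suc D"] exI[of _ s] exI[of _ T] exI[of _ j] exI[of _ E]) auto
qed

lemma safe_step:
  assumes safe: "safe W m" and m: "m < h" and f: "\<forall>i>n. f i = 0"
  shows "(\<exists>a. (\<exists>S\<subseteq>{..<n}. sum f S = a) \<and> safe (adjoin (f(n := a)) W) m) \<or>
    (\<exists>a b. a \<noteq> b \<and> (\<exists>S\<subseteq>{..<n}. sum f S = a) \<and> (\<exists>S\<subseteq>{..<n}. sum f S = b) \<and>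
      safe (adjoin (f(n := a)) W) (Suc m) \<and> safe (adjoin (f(n := b)) W) (Suc m))"
    (is "?answer \<or> ?branch")
proof -
  obtain D s T j E where W: "extends D W" and D: "D = s + m" and t: "tracked W j T E"
    and light: "\<forall>e\<in>W. wt n e \<le> w \<longrightarrow> e \<in> T" and ne: "sols n T \<noteq> {}"
    and j: "card E + s \<le> j" "j \<le> D"
    using safe unfolding safe_def by blast
  have W': "eq_space W" "consistent n W" using W by (auto simp: extends_def)
  have T: "eq_space T" "T \<subseteq> W" using t by (auto simp: tracked_def)
  have vals: "\<exists>S\<subseteq>{..<n}. sum f S = a" if "w < wt n f" for a
    using heavy_form_values[OF that] m by simp
  show ?thesis
  proof (cases "\<exists>a. f(n := a) \<in> W")
    case True
    then obtain a where a: "f(n := a) \<in> W" by auto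
    \<comment> \<open>The forced value is attained on the cube: a heavy form takes all values, and a
      light equation lies in \<open>T\<close>, which has a Boolean solution.\<close>
    have "\<exists>S\<subseteq>{..<n}. sum f S = a"
    proof (cases "w < wt n f")
      case False
      then have "f(n := a) \<in> T"
        using a light wt_cong[of n "f(n := a)" f] by simp
      then obtain S where S: "S \<subseteq> {..<n}" "sum (f(n := a)) S = a"
        using ne by (force simp: sols_def)
      moreover have "sum (f(n := a)) S = sum f S"
        using S by (intro sum.cong) auto
      ultimately show ?thesis by auto
    qed (rule vals)
    moreover have "safe (adjoin (f(n := a)) W) m"
      using safe adjoin_absorb[OF W'(1) a] by simp
    ultimately show ?thesis by blast
  next
    case False
    then have new: "\<forall>a. f(n := a) \<notin> W" by auto
    \<comment> \<open>Since \<open>m < h\<close>, the bound \<open>p * m\<close> on \<open>D\<close>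
      stays \<open>p\<close> below \<open>M\<close>, leaving room for one more dimension.\<close>
    have "D \<le> p * m"
      unfolding D using t ne W'(2) j D by (intro tracked_dim_bound[of W j T E]) auto
    also have "p * m + p \<le> M"
      unfolding M using m by (metis Suc_leI add.commute mult_Suc_right mult_le_mono2)
    finally have DM: "Suc D \<le> M" using p_gt_1 by linarith
    show ?thesis
    proof (cases "\<forall>u\<in>W. w < wt n (\<lambda>i. f i + u i)")
      case True
      have heavy_f: "w < wt n f"
        using bspec[OF True zero_in_eq_space[OF W'(1)]] by simp
      have "safe (adjoin (f(n := a)) W) (Suc m)" for a
        using W t light ne f new True j D by (rule safe_heavy)
      then show ?thesis
        using vals[OF heavy_f] zero_neq_one[where 'a = "'p mod_ring"]
        by (intro disjI2 exI[of _ 0] exI[of _ 1]) simp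
    next
      case False
      then obtain u where u: "u \<in> W" "wt n (\<lambda>i. f i + u i) \<le> w" by auto
      let ?g = "\<lambda>i. f i + u i"
      obtain T' j' E' where t': "tracked W j' T' E'" and sub: "T \<subseteq> T'" and j': "j' \<le> D"
        "card E' + j \<le> card E + j'" and sat: "\<forall>e\<in>W. wt n e \<le> 2 * w \<longrightarrow> e \<in> T'"
        using saturate[OF W DM t j(2)] by (elim exE conjE) (rule that)
      have T': "finite E'" "sols n T' = sols n E'"
        using t' by (auto simp: tracked_def)
      have ne': "sols n T' \<noteq> {}"
        using j j' DM by (intro sols_saturated[OF t t' sub light ne]) auto
      \<comment> \<open>Legality of the offered value: if \<open>f\<close> is light, then
        \<open>u\<close> weighs at most \<open>2 * w\<close> and lies in \<open>T'\<close>, so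
        \<open>S\<close> itself attains the value.\<close>
      have val: "\<exists>U\<subseteq>{..<n}. sum f U = sum ?g S - u n" if S: "S \<in> sols n T'" for S
      proof (cases "w < wt n f")
        case False
        have "wt n u \<le> 2 * w"
          using wt_diff[of n ?g 1 f] u(2) False by simp
        then have "sum u S = u n"
          using sat u(1) S by (auto simp: sols_def)
        then show ?thesis
          using S by (auto simp: sols_def sum.distrib)
      qed (rule vals)
      have step: "safe (adjoin (f(n := sum ?g S - u n)) W) m'"
        if "S \<in> sols n T'" "finite F" "sols n F = {U \<in> sols n T'. sum ?g U = sum ?g S}"
          "card F + s' \<le> Suc j'" "Suc D = s' + m'" for S s' m' and F :: "(nat \<Rightarrow> 'p mod_ring) set"
        using safe_light[OF W t' sat f new u that(1) refl that(2,3,4) j'(1) that(5)] .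
      obtain S where S: "S \<in> sols n T'" using ne' by auto
      show ?thesis
      proof (cases "\<forall>U\<in>sols n T'. sum ?g U = sum ?g S")
        case True
        \<comment> \<open>\<open>g\<close> is constant on the solutions, so its equation costs
          nothing in \<open>E'\<close>: the dimension grows by one and the surplus becomes
          \<open>Suc s\<close>.\<close>
        have "safe (adjoin (f(n := sum ?g S - u n)) W) m"
          using True T' j j' D by (intro step[OF S, of E' "Suc s"]) auto
        then show ?thesis using val[OF S] by blast
      next
        case False
        then obtain R where R: "R \<in> sols n T'" "sum ?g R \<noteq> sum ?g S" by auto
        \<comment> \<open>Here the equation for \<open>g\<close> cuts the solution set and must
          enter \<open>E'\<close>; the new dimension is charged to the branching point, and
          \<open>s\<close> is unchanged.\<close>
        have branch: "safe (adjoin (f(n := sum ?g U - u n)) W) (Suc m)" if U: "U \<in> sols n T'" for U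
        proof (rule step[OF U, of "insert (?g(n := sum ?g U)) E'" s])
          have "sum (?g(n := sum ?g U)) V = sum ?g V" if "V \<in> sols n T'" for V
            using that by (intro sum.cong) (auto simp: sols_def)
          then show "sols n (insert (?g(n := sum ?g U)) E') = {V \<in> sols n T'. sum ?g V = sum ?g U}"
            by (auto simp: sols_insert T'(2))
          have "card (insert (?g(n := sum ?g U)) E') \<le> Suc (card E')"
            by (rule card_insert_le_m1) simp_all
          then show "card (insert (?g(n := sum ?g U)) E') + s \<le> Suc j'"
            using j j' by simp
        qed (use T' D in auto)
        have "sum ?g R - u n \<noteq> sum ?g S - u n" using R(2) by simp
        then show ?thesis
          by (intro disjI2 exI[of _ "sum ?g R - u n"] exI[of _ "sum ?g S - u n"] conjI
              val branch R(1) S)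
      qed
    qed
  qed
qed

lemma safe_initial:
  assumes "consistent n W0" "0 < h"
  shows "safe W0 0"
proof -
  have "w \<le> 2 * w * M"
    using assms p_gt_1 by (simp add: M)
  then have "e = (\<lambda>_. 0)" if "e \<in> W0" "wt n e \<le> w" for e
    using that heavy[OF that(1)] by (meson leD le_trans)
  moreover have "tracked W0 0 {\<lambda>_. 0} {}"
    using zero_in_eq_space[OF W0]
    by (auto simp: tracked_def eq_space_zero sols_def wt_def)
  moreover have "{} \<in> sols n {\<lambda>_. 0 :: 'p mod_ring}"
    by (simp add: sols_def)
  moreover have "extends 0 W0"
    using W0 assms by (simp add: extends_def)
  ultimately show ?thesis
    unfolding safe_def
    by (intro exI[of _ "0::nat"] exI[of _ "{\<lambda>_. 0}"] exI[of _ "{} :: (nat \<Rightarrow> 'p mod_ring) set"]) auto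
qed

lemma safe_consistent: "safe W m \<Longrightarrow> eq_space W \<and> consistent n W"
  unfolding safe_def extends_def by blast

end

section \<open>The game\<close>

definition form_coeffs :: "nat \<Rightarrow> 'a::field vec \<Rightarrow> nat \<Rightarrow> 'a" where
  "form_coeffs n f = (\<lambda>i. if i < n then f $ i else 0)"

definition eq_span :: "nat \<Rightarrow> 'a::field lin_eq list \<Rightarrow> (nat \<Rightarrow> 'a) set" where
  "eq_span n es = foldl (\<lambda>V (f, a). adjoin ((form_coeffs n f)(n := a)) V) {\<lambda>_. 0} es"

lemma eq_span_Nil [simp]: "eq_span n [] = {\<lambda>_. 0}"
  and eq_span_snoc [simp]: "eq_span n (es @ [(f, a)]) = adjoin ((form_coeffs n f)(n := a)) (eq_span n es)"
  by (simp_all add: eq_span_def)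

lemma eq_space_eq_span: "eq_space (eq_span n (es :: 'a::{field,finite} lin_eq list))"
proof (induction es rule: rev_induct)
  case (snoc e es)
  then show ?case by (cases e) (simp add: eq_space_adjoin)
qed (simp add: eq_space_zero)

lemma eq_span_contains:
  fixes es :: "'a::{field,finite} lin_eq list"
  assumes "(f, a) \<in> set es"
  shows "(form_coeffs n f)(n := a) \<in> eq_span n es"
  using assms
proof (induction es rule: rev_induct)
  case (snoc e es)
  obtain g c where e: "e = (g, c)" by (cases e)
  show ?case
  proof (cases "(f, a) = (g, c)")
    case True
    then have fa: "f = g" "a = c" by auto
    show ?thesis
      unfolding e fa eq_span_snoc by (rule adjoin_new[OF eq_space_eq_span])
  next
    case False
    then have "(f, a) \<in> set es" using snoc.prems e by auto
    from subsetD[OF adjoin_base snoc.IH[OF this]] show ?thesis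
      unfolding e eq_span_snoc .
  qed
qed simp

lemma eq_span_map_upt:
  assumes "e \<in> eq_span n (map (\<lambda>i. (f i, c i)) [0..<k])"
  obtains y where "e = (\<lambda>j. \<Sum>i<k. y i * ((form_coeffs n (f i))(n := c i)) j)"
  using assms
proof (induction k arbitrary: e thesis)
  case 0
  then show ?case by simp
next
  case (Suc k)
  obtain v a where v: "v \<in> eq_span n (map (\<lambda>i. (f i, c i)) [0..<k])"
    "e = (\<lambda>j. v j + a * ((form_coeffs n (f k))(n := c k)) j)"
    using Suc.prems(2) by (auto elim!: adjoinE)
  obtain y where y: "v = (\<lambda>j. \<Sum>i<k. y i * ((form_coeffs n (f i))(n := c i)) j)"
    using Suc.IH[OF _ v(1)] .
  show ?case
    by (rule Suc.prems(1)[of "y(k := a)"]) (simp add: v(2) y)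
qed

definition row_eqs :: "'a mat \<Rightarrow> 'a vec \<Rightarrow> 'a lin_eq list" where
  "row_eqs A b = map (\<lambda>i. (row A i, b $ i)) [0..<dim_row A]"

lemma set_rows: "set (row_eqs A b) = system A b"
  by (auto simp: row_eqs_def system_def)

text \<open>\<open>e\<close> is a combination of the rows with right-hand sides; as \<open>e\<close>
  is nonzero, so is the coefficient vector, which therefore competes in the minimum.\<close>

lemma min_weight_le:
  assumes A: "A \<in> carrier_mat k n" and e: "e \<in> eq_span n (row_eqs A b)" "e \<noteq> (\<lambda>_. 0)"
  shows "min_weight A \<le> wt n e"
proof -
  have k: "dim_row A = k" "dim_col A = n" using A by auto
  obtain y where y: "e = (\<lambda>j. \<Sum>i<k. y i * ((form_coeffs n (row A i))(n := b $ i)) j)"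
    using e(1) unfolding row_eqs_def k by (rule eq_span_map_upt)
  let ?y = "vec k y"
  have "?y \<noteq> 0\<^sub>v k"
  proof
    assume "?y = 0\<^sub>v k"
    then have "y i = 0" if "i < k" for i
      using that by (metis index_vec index_zero_vec(1))
    then show False using e(2) by (simp add: y)
  qed
  let ?X = "{weight (transpose_mat A *\<^sub>v y) |y. y \<in> carrier_vec (dim_row A) \<and> y \<noteq> 0\<^sub>v (dim_row A)}"
  have wt_dim: "weight v \<le> dim_vec v" for v :: "'a vec"
    using card_mono[of "{..<dim_vec v}" "{i. i < dim_vec v \<and> v $ i \<noteq> 0}"]
    by (auto simp: weight_def)
  then have "?X \<subseteq> {..n}"
    using k by (auto intro!: order_trans[OF wt_dim])
  then have "finite ?X" by (rule finite_subset) simp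
  moreover have "weight (transpose_mat A *\<^sub>v ?y) \<in> ?X"
    using \<open>?y \<noteq> 0\<^sub>v k\<close> k by auto
  ultimately have "min_weight A \<le> weight (transpose_mat A *\<^sub>v ?y)"
    unfolding min_weight_def by (rule Min_le)
  also have "(transpose_mat A *\<^sub>v ?y) $ j = e j" if "j < n" for j
    using that k by (auto simp: y scalar_prod_def form_coeffs_def lessThan_atLeast0 mult.commute intro!: sum.cong)
  then have "weight (transpose_mat A *\<^sub>v ?y) = wt n e"
    using k by (simp add: weight_def wt_def cong: conj_cong)
  finally show ?thesis .
qed

text \<open>A row combination with zero form has weight 0, below the minimum, so its right-hand side
  vanishes too.\<close>

lemma consistent_rows:
  assumes A: "A \<in> carrier_mat k n" and "0 < min_weight A"
  shows "consistent n (eq_span n (row_eqs A b))"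
  unfolding consistent_def
proof (intro ballI conjI impI)
  fix e assume e: "e \<in> eq_span n (row_eqs A b)"
  then obtain y where "e = (\<lambda>j. \<Sum>i<dim_row A. y i * ((form_coeffs n (row A i))(n := b $ i)) j)"
    unfolding row_eqs_def by (rule eq_span_map_upt)
  then show "\<forall>i>n. e i = 0" by (simp add: form_coeffs_def)
  assume "\<forall>i<n. e i = 0"
  then have "wt n e = 0" by (simp add: wt_eq_0_iff)
  then have "e = (\<lambda>_. 0)"
    using min_weight_le[OF A e] assms(2) by fastforce
  then show "e n = 0" by simp
qed

lemma solvable_eq_span:
  fixes es :: "'a::{field,finite} lin_eq list"
  assumes cons: "consistent n (eq_span n es)" and carrier: "\<forall>(f, a)\<in>set es. f \<in> carrier_vec n"
  shows "solvable n (set es)"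
proof -
  obtain x where x: "\<forall>e\<in>eq_span n es. (\<Sum>i<n. e i * x i) = e n"
    using consistent_solution[OF eq_space_eq_span cons] by auto
  have "f \<bullet> vec n x = a" if e: "(f, a) \<in> set es" for f a
  proof -
    have "(\<Sum>i<n. ((form_coeffs n f)(n := a)) i * x i) = a"
      using bspec[OF x eq_span_contains[OF e]] by simp
    then show ?thesis
      by (simp add: scalar_prod_def form_coeffs_def lessThan_atLeast0)
  qed
  then show ?thesis
    unfolding solvable_def by (intro bexI[of _ "vec n x"]) auto
qed

lemma rows_carrier: "A \<in> carrier_mat k n \<Longrightarrow> \<forall>(f, a)\<in>set (row_eqs A b). f \<in> carrier_vec n"
  by (auto simp: row_eqs_def)

lemma boolean_valuesI:
  assumes f: "f \<in> carrier_vec n" and S: "S \<subseteq> {..<n}"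
  shows "sum (form_coeffs n f) S \<in> boolean_values n f"
proof -
  let ?x = "vec n (\<lambda>i. if i \<in> S then 1 else 0)"
  have "sum (form_coeffs n f) S = (\<Sum>i<n. if i \<in> S then f $ i else 0)"
    using S by (intro sum.mono_neutral_cong_left) (auto simp: form_coeffs_def)
  also have "\<dots> = f \<bullet> ?x"
    by (auto simp: scalar_prod_def lessThan_atLeast0 intro!: sum.cong)
  finally show ?thesis
    unfolding boolean_values_def boolean_points_def by auto
qed

section \<open>Strategies from invariants\<close>

lemma zero_boolean_value: "f \<in> carrier_vec n \<Longrightarrow> 0 \<in> boolean_values n f"
  using boolean_valuesI[of f n "{}"] by simp

text \<open>Choosing a response that preserves \<open>P\<close> in every round gives the strategy;
  once \<open>h\<close> branching points have occurred, any legal response will do.\<close>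

lemma guaranteesI:
  fixes P :: "'a::field lin_eq list \<Rightarrow> nat \<Rightarrow> bool"
  assumes start: "P [] 0"
    and step: "\<And>es m f. P es m \<Longrightarrow> m < h \<Longrightarrow> f \<in> carrier_vec n \<Longrightarrow>
      \<exists>r. legal_response n f r \<and> (\<forall>a\<in>outcomes r. P (es @ [(f, a)]) (m + branch_count r))"
    and solv: "\<And>es m. P es m \<Longrightarrow> m < h \<Longrightarrow> solvable n (F \<union> set es)"
  shows "\<exists>S. guarantees n F S h"
proof -
  define good where "good es m f r \<longleftrightarrow> legal_response n f r \<and>
    (\<forall>a\<in>outcomes r. P (es @ [(f, a)]) (m + branch_count r))"
    for es :: "'a lin_eq list" and m :: nat and f :: "'a vec" and r :: "'a response"
  \<comment> \<open>\<open>Answer 0\<close> is the default because every form takes the value 0 at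
    the origin.\<close>
  define resp where "resp es m f = (if \<exists>r. good es m f r then SOME r. good es m f r else Answer 0)"
    for es m f
  \<comment> \<open>The strategy sees only the equations, so the number of earlier branching points
    is recomputed by replaying it; the list is reversed to recurse from the latest round.\<close>
  define branches where "branches = rec_list 0 (\<lambda>e es m. m + branch_count (resp (rev es) m (fst e)))"
  define S where "S es f = resp es (branches (rev es)) f" for es f
  have good: "good es m f (resp es m f)" if "\<exists>r. good es m f r" for es m f
    using that by (simp add: resp_def someI_ex)
  have legal: "legal_strategy n S"
    unfolding legal_strategy_def
  proof (intro allI ballI)
    fix es and f :: "'a vec" assume f: "f \<in> carrier_vec n"
    show "legal_response n f (S es f)"
    proof (cases "\<exists>r. good es (branches (rev es)) f r")
      case True
      from good[OF this] show ?thesis by (simp add: S_def good_def)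
    next
      case False
      then show ?thesis using f by (simp add: S_def resp_def zero_boolean_value)
    qed
  qed
  have inv: "m = branches (rev es) \<and> (P es m \<or> h \<le> m)" if "play n F S es m" for es m
    using that
  proof induction
    case start
    then show ?case using \<open>P [] 0\<close> by (simp add: branches_def)
  next
    case (round es m f a)
    have S: "S es f = resp es m f"
      using round by (simp add: S_def)
    have "branches (rev (es @ [(f, a)])) = m + branch_count (S es f)"
      using round by (simp add: S branches_def)
    moreover have "P (es @ [(f, a)]) (m + branch_count (S es f))" if m: "m < h"
    proof -
      have "P es m" using round.IH m by linarith
      from step[OF this m \<open>f \<in> carrier_vec n\<close>] have "good es m f (resp es m f)"
        unfolding good_def[symmetric] by (rule good)
      then show ?thesis using round S by (simp add: good_def)
    qed
    moreover have "h \<le> m + branch_count (S es f)" if "\<not> m < h"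
      using that by simp
    ultimately show ?case by auto
  qed
  have "h \<le> m" if "play n F S es m" "\<not> solvable n (F \<union> set es)" for es m
  proof (rule ccontr)
    assume "\<not> h \<le> m"
    then have "P es m" "m < h" using inv[OF that(1)] by auto
    then show False using solv that(2) by blast
  qed
  with legal show ?thesis
    unfolding guarantees_def by blast
qed

text \<open>Zero forms get the answer 0 and leave the solvable system as it was; the first nonzero
  form has a nonzero coefficient and thus two Boolean values. This covers minimum weights too small
  for the general bound.\<close>

lemma guarantees_one:
  assumes A: "A \<in> carrier_mat k n" and d: "0 < min_weight (A :: 'a::{field,finite} mat)"
  shows "\<exists>S. guarantees n (system A b) S 1"
proof -
  let ?P = "\<lambda>es m. (0::nat) < m \<or> (\<forall>(f, a)\<in>set es. f = 0\<^sub>v n \<and> a = (0::'a))"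
  show ?thesis
  proof (rule guaranteesI[where P = ?P])
    show "?P [] 0" by simp
    fix es :: "'a lin_eq list" and m :: nat
    assume *: "?P es m" "m < 1"
    have zero: "\<forall>(f, a)\<in>set es. f = 0\<^sub>v n \<and> a = 0"
      using * by simp
    have "solvable n (set (row_eqs A b))"
      using consistent_rows[OF A d] rows_carrier[OF A] by (rule solvable_eq_span)
    then show "solvable n (system A b \<union> set es)"
      unfolding set_rows using zero by (fastforce simp: solvable_def)
    fix f :: "'a vec" assume f: "f \<in> carrier_vec n"
    show "\<exists>r. legal_response n f r \<and> (\<forall>a\<in>outcomes r. ?P (es @ [(f, a)]) (m + branch_count r))"
    proof (cases "f = 0\<^sub>v n")
      case True
      then show ?thesis
        using * zero_boolean_value[OF f] by (intro exI[of _ "Answer 0"]) simp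
    next
      case False
      then obtain i where i: "i < n" "f $ i \<noteq> 0"
        using f by (metis carrier_vecD eq_vecI index_zero_vec)
      then have "f $ i \<in> boolean_values n f"
        using boolean_valuesI[OF f, of "{i}"] by (simp add: form_coeffs_def)
      then show ?thesis
        using i(2) zero_boolean_value[OF f] by (intro exI[of _ "Branch 0 (f $ i)"]) simp
    qed
  qed
qed

context delayer begin

lemma guarantees_safe:
  assumes A: "A \<in> carrier_mat k n" and rows: "W0 = eq_span n (row_eqs A b)"
    and "consistent n W0" "0 < h"
  shows "\<exists>S. guarantees n (system A b) S h"
proof -
  let ?P = "\<lambda>es m. safe (eq_span n (row_eqs A b @ es)) m \<and> (\<forall>(f, a)\<in>set es. f \<in> carrier_vec n)"
  show ?thesis
  proof (rule guaranteesI[where P = ?P])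
    show "?P [] 0"
      using safe_initial[OF assms(3,4)] rows by simp
    fix es m assume P: "?P es m" and m: "m < h"
    have "consistent n (eq_span n (row_eqs A b @ es))"
      using P safe_consistent by blast
    moreover have "\<forall>(f, a)\<in>set (row_eqs A b @ es). f \<in> carrier_vec n"
      using P rows_carrier[OF A, of b] by auto
    ultimately show "solvable n (system A b \<union> set es)"
      using solvable_eq_span[of n "row_eqs A b @ es"] by (simp add: set_rows)
    fix f :: "'p mod_ring vec" assume f: "f \<in> carrier_vec n"
    let ?W = "\<lambda>a. adjoin ((form_coeffs n f)(n := a)) (eq_span n (row_eqs A b @ es))"
    have W: "eq_span n (row_eqs A b @ es @ [(f, a)]) = ?W a" for a
      unfolding append_assoc[symmetric] by (rule eq_span_snoc)
    have bool: "a \<in> boolean_values n f" if "\<exists>S\<subseteq>{..<n}. sum (form_coeffs n f) S = a" for a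
      using that boolean_valuesI[OF f] by auto
    have "\<forall>i>n. form_coeffs n f i = 0" by (simp add: form_coeffs_def)
    from safe_step[OF conjunct1[OF P] m this]
    show "\<exists>r. legal_response n f r \<and> (\<forall>a\<in>outcomes r. ?P (es @ [(f, a)]) (m + branch_count r))"
    proof (elim disjE exE conjE)
      fix a S assume "S \<subseteq> {..<n}" "sum (form_coeffs n f) S = a" "safe (?W a) m"
      then show ?thesis
        using P f bool W by (intro exI[of _ "Answer a"]) auto
    next
      fix a c S R assume "a \<noteq> c" "S \<subseteq> {..<n}" "sum (form_coeffs n f) S = a"
        "R \<subseteq> {..<n}" "sum (form_coeffs n f) R = c" "safe (?W a) (Suc m)" "safe (?W c) (Suc m)"
      then show ?thesis
        using P f bool W by (intro exI[of _ "Branch a c"]) auto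
    qed
  qed
qed

end

section \<open>Choice of constants\<close>

lemma guarantees_sqrt:
  obtains K :: nat where "0 < K"
    "\<And>k n h b (A :: 'p::prime_card mod_ring mat). A \<in> carrier_mat k n \<Longrightarrow> 0 < h \<Longrightarrow>
      K * h\<^sup>2 \<le> min_weight A \<Longrightarrow> \<exists>S. guarantees n (system A b) S h"
proof -
  define p where "p = CARD('p)"
  have p: "1 < p"
    using prime_gt_1_nat[OF prime_card[where 'a = 'p]] by (simp add: p_def)
  obtain \<gamma> where \<gamma>: "0 < \<gamma>" "\<gamma> < 1" "\<And>a::'p mod_ring. a \<noteq> 0 \<Longrightarrow> norm (1 + character a) \<le> 2 * \<gamma>"
    using character_contraction by blast
  \<comment> \<open>With \<open>w = C * M\<close> the smallness condition becomes the
    \<open>M\<close>-th power of \<open>p * 2 ^ p * \<gamma> ^ C < 1\<close>.\<close>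
  obtain C where C: "\<gamma> ^ C < 1 / (real p * 2 ^ p)"
    using real_arch_pow_inv[OF _ \<gamma>(2), of "1 / (real p * 2 ^ p)"] p by auto
  show thesis
  \<comment> \<open>As \<open>M = p * h\<close>, heaviness asks for a minimum weight above
    \<open>2 * C * M * M\<close>, which is quadratic in \<open>h\<close>; the summand 1 makes the
    inequality strict.\<close>
  proof (rule that[of "2 * C * p\<^sup>2 + 1"])
    fix k n h b and A :: "'p mod_ring mat"
    assume A: "A \<in> carrier_mat k n" and h: "0 < h" and d: "(2 * C * p\<^sup>2 + 1) * h\<^sup>2 \<le> min_weight A"
    define M where "M = p * h"
    have M: "0 < M" using p h by (simp add: M_def)
    have "2 * (C * M) * M = 2 * C * p\<^sup>2 * h\<^sup>2"
      by (simp add: M_def power2_eq_square)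
    also have "\<dots> < (2 * C * p\<^sup>2 + 1) * h\<^sup>2"
      using h by simp
    finally have wM: "2 * (C * M) * M < min_weight A"
      using d by simp
    have "real (p ^ M * 2 ^ (p * M)) * \<gamma> ^ (C * M) = (real p * 2 ^ p * \<gamma> ^ C) ^ M"
      by (simp add: power_mult power_mult_distrib)
    also have "\<dots> < 1"
      using C p M \<gamma> by (intro power_Suc_less_one power_less_one_iff[THEN iffD2]) (auto simp: field_simps)
    finally have small: "real (p ^ M * 2 ^ (p * M)) * \<gamma> ^ (C * M) < 1" .
    interpret delayer n "C * M" h p M \<gamma> "eq_span n (row_eqs A b)"
    proof
      fix e assume "e \<in> eq_span n (row_eqs A b)" "e \<noteq> (\<lambda>_. 0)"
      then show "2 * (C * M) * M < wt n e"
        using min_weight_le[OF A] wM by fastforce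
    qed (use p_def M_def \<gamma> small eq_space_eq_span in auto)
    show "\<exists>S. guarantees n (system A b) S h"
      using consistent_rows[OF A] wM h by (intro guarantees_safe[OF A refl]) auto
  qed simp
qed

theorem theorem5p4:
  assumes "CARD('p::prime_card) \<ge> 5"
  shows "\<exists>c::real. c > 0 \<and>
    (\<forall>(k::nat) (n::nat) (d::nat) (A :: 'p mod_ring mat) (b :: 'p mod_ring vec).
       A \<in> carrier_mat k n \<longrightarrow> vec_space.rank k A = k \<longrightarrow> min_weight A = d \<longrightarrow>
       b \<in> carrier_vec k \<longrightarrow> \<not> (\<exists>x \<in> boolean_points n. A *\<^sub>v x = b) \<longrightarrow>
       (\<exists>S h. guarantees n (system A b) S h \<and> real h \<ge> c * real d powr 0.2))"
proof -
  obtain K :: nat where K: "0 < K"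
    "\<And>k n h b (A :: 'p mod_ring mat). A \<in> carrier_mat k n \<Longrightarrow> 0 < h \<Longrightarrow>
      K * h\<^sup>2 \<le> min_weight A \<Longrightarrow> \<exists>S. guarantees n (system A b) S h"
    by (rule guarantees_sqrt) blast
  \<comment> \<open>This makes \<open>c * sqrt d\<close> half of \<open>x = sqrt (d / K)\<close>;
    the factor 2 absorbs rounding \<open>x\<close> down.\<close>
  define c where "c = 1 / (2 * sqrt (real K))"
  have "c > 0" using K(1) by (simp add: c_def)
  moreover have "\<exists>S h. guarantees n (system A b) S h \<and> c * real (min_weight A) powr 0.2 \<le> real h"
    if A: "A \<in> carrier_mat k n" for k n b and A :: "'p mod_ring mat"
  proof (cases "min_weight A = 0")
    case True
    have "\<exists>S. guarantees n (system A b) S 0"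
      by (rule guaranteesI[where P = "\<lambda>_ _. True"]) auto
    then show ?thesis using True by auto
  next
    case False
    define d where "d = min_weight A"
    define x where "x = sqrt (real d / real K)"
    have "real d powr 0.2 \<le> real d powr (1 / 2)"
      using False by (intro powr_mono) (auto simp: d_def)
    then have "real d powr 0.2 \<le> sqrt (real d)"
      by (simp add: powr_half_sqrt)
    then have "c * real d powr 0.2 \<le> c * sqrt (real d)"
      using \<open>c > 0\<close> by (intro mult_left_mono) auto
    also have "c * sqrt (real d) = x / 2"
      by (simp add: c_def x_def real_sqrt_divide)
    finally have cx: "c * real d powr 0.2 \<le> x / 2" .
    show ?thesis
    \<comment> \<open>For \<open>x < 1\<close> the bound asked for is below 1, so a single branching
      point suffices; otherwise the floor of \<open>x\<close> is an admissible
      \<open>h\<close>.\<close>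
    proof (cases "x < 1")
      case True
      moreover obtain S where "guarantees n (system A b) S 1"
        using guarantees_one[OF A] False by auto
      ultimately show ?thesis
        using cx unfolding d_def by (intro exI[of _ S] exI[of _ "1::nat"]) auto
    next
      case False
      define h where "h = nat \<lfloor>x\<rfloor>"
      have h: "real h \<le> x" "x < real h + 1" "1 \<le> h"
        using False by (auto simp: h_def le_nat_floor)
      have "(real h)\<^sup>2 \<le> x\<^sup>2"
        using h by (intro power_mono) auto
      also have "x\<^sup>2 = real d / real K"
        by (simp add: x_def)
      finally have "real (K * h\<^sup>2) \<le> real d"
        using K(1) by (simp add: field_simps)
      then have "K * h\<^sup>2 \<le> min_weight A"
        unfolding d_def of_nat_le_iff .
      then obtain S where "guarantees n (system A b) S h"
        using K(2)[OF A] h by fastforce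
      moreover have "x / 2 \<le> real h"
        using h by linarith
      ultimately show ?thesis
        using cx unfolding d_def by (intro exI[of _ S] exI[of _ h]) auto
    qed
  qed
  ultimately show ?thesis by blast
qed

end
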